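(* Let $0<\delta<1$. Suppose the standing setting and Assumption (A) below hold, and that the integer $k$ satisfies $$2^8 \cdot D \log^2(4/\delta)\cdot \log n \;\le\; k \;\le\; \tfrac12\cdot \omega\cdot p_{X,0}\cdot v_D\cdot r_0^D\cdot n,$$ where $v_D := \frac{\pi^{D/2}}{\Gamma(D/2+1)}$ is the volume of the $D$-dimensional unit ball. Then with probability at least $1-\delta$ (over the sample), $$\sup_{x\in\mathcal{X}} |\eta_k(x)-\eta(x)| \;\le\; C_\alpha\left(\frac{2k}{\omega\cdot v_D\cdot n\cdot p_{X,0}}\right)^{\alpha/D} + \sqrt{\frac{2\log(4D/\delta)+2D\log(n)}{k}}.$$
   Context: Standing setting (binary classification): $\mathcal{X}\subseteq\mathbb{R}^D$ is compact; $p_X$ is a probability density on $\mathcal{X}$ with distribution $\mathcal{P}$; $\eta:\mathcal{X}\to[0,1]$ is the label function. The sample $(x_1,y_1),\dots,(x_n,y_n)$ is i.i.d.: $x_i\sim p_X$ and $y_i\in\{0,1\}$ with $\mathbb{P}(y_i=1\mid x_i=x)=\eta(x)$. Write $X:=\{x_1,\dots,x_n\}$ and $B(x,r):=\{x'\in\mathcal{X}: |x-x'|\le r\}$ (Euclidean norm). The $k$-NN radius is $r_k(x):=\inf\{r: |B(x,r)\cap X|\ge k\}$, the $k$-NN set is $N_k(x):=B(x,r_k(x))\cap X$, and the $k$-NN label is $\eta_k(x):=\frac{1}{|N_k(x)|}\sum_{i=1}^n y_i\,\mathbf{1}[x_i\in N_k(x)]$. Assumption (A): (i) (support regularity) there exist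 $\omega>0$, $r_0>0$ with $\mathrm{Vol}(\mathcal{X}\cap B(x,r))\ge \omega\cdot \mathrm{Vol}(B(x,r))$ for all $x\in\mathcal{X}$ and $0<r<r_0$; (ii) (non-vanishing density) $p_{X,0}:=\inf_{x\in\mathcal{X}} p_X(x)>0$; (iii) (Hölder smoothness) there exist $0<\alpha\le 1$ and $C_\alpha>0$ with $|\eta(x)-\eta(x')|\le C_\alpha|x-x'|^\alpha$ for all $x,x'\in\mathcal{X}$. *)

theory Defs
  imports "HOL-Analysis.Analysis" "HOL-Probability.Probability"
begin

text \<open>A sample of size n is a function S :: nat => 'a * bool on the indices {..<n};
  S i = (x_i, y_i), where the label y_i = 1 is encoded as True.\<close>

definition knn_count :: "(nat \<Rightarrow> 'a::metric_space \<times> bool) \<Rightarrow> nat \<Rightarrow> 'a \<Rightarrow> real \<Rightarrow> nat" where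
  "knn_count S n x r = card {i \<in> {..<n}. dist x (fst (S i)) \<le> r}"

definition knn_radius :: "(nat \<Rightarrow> 'a::metric_space \<times> bool) \<Rightarrow> nat \<Rightarrow> nat \<Rightarrow> 'a \<Rightarrow> real" where
  "knn_radius S n k x = Inf {r. k \<le> knn_count S n x r}"

definition knn_set :: "(nat \<Rightarrow> 'a::metric_space \<times> bool) \<Rightarrow> nat \<Rightarrow> nat \<Rightarrow> 'a \<Rightarrow> nat set" where
  "knn_set S n k x = {i \<in> {..<n}. dist x (fst (S i)) \<le> knn_radius S n k x}"

definition knn_label :: "(nat \<Rightarrow> 'a::metric_space \<times> bool) \<Rightarrow> nat \<Rightarrow> nat \<Rightarrow> 'a \<Rightarrow> real" where
  "knn_label S n k x =
     (\<Sum>i\<in>knn_set S n k x. (if snd (S i) then 1 else 0)) / real (card (knn_set S n k x))"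

definition pair_dist :: "'a::euclidean_space set \<Rightarrow> ('a \<Rightarrow> real) \<Rightarrow> ('a \<Rightarrow> real) \<Rightarrow> ('a \<times> bool) measure" where
  "pair_dist X p eta = density (lborel \<Otimes>\<^sub>M count_space UNIV)
     (\<lambda>(x, b). ennreal (p x * indicator X x * (if b then eta x else 1 - eta x)))"

definition sample_dist :: "nat \<Rightarrow> 'a::euclidean_space set \<Rightarrow> ('a \<Rightarrow> real) \<Rightarrow> ('a \<Rightarrow> real)
    \<Rightarrow> (nat \<Rightarrow> 'a \<times> bool) measure" where
  "sample_dist n X p eta = PiM {..<n} (\<lambda>_. pair_dist X p eta)"

end

theory Submission
  imports Defs
begin

text \<open>Let \<open>r = (2k / (\<omega> v\<^sub>D n p\<^sub>0))\<^bsup>1/D\<^esup>\<close>, so that balls of radius \<open>r\<close> centred in \<open>X\<close> have mass at least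
  \<open>2k/n\<close>. If all of them contain \<open>k\<close> sample points, the \<open>k\<close>-NN radius is at most \<open>r\<close> and Hoelder
  smoothness bounds the bias.

  Such a uniform lower bound on the counts needs no uniform law of large numbers: since the mass of
  small balls is bounded below, \<open>X\<close> has a net of mesh \<open>r/(10D)\<close> with at most \<open>n\<^bsup>D+1\<^esup>\<close> points, every
  ball of radius \<open>r\<close> contains a ball of radius \<open>(1 - 1/(10D)) r\<close> around a net point, and a Chernoff bound
  applies to each of these.

  For the variance, a \<open>k\<close>-NN set is the trace of a ball on the sample. Given the sample points there
  are at most \<open>(n+1)\<^bsup>D+1\<^esup>\<close> such traces (Radon's theorem and the Sauer-Shelah lemma), and the labels
  are independent, so Hoeffding's inequality and a union bound suffice. Conditioning on the sample
  points is avoided by integrating out the labels one at a time from the exponential moment.\<close>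

section \<open>Traces of balls on finite sets\<close>

definition shatters :: "'i set set \<Rightarrow> 'i set \<Rightarrow> bool" where
  "shatters F A \<longleftrightarrow> (\<forall>B\<subseteq>A. \<exists>I\<in>F. I \<inter> A = B)"

lemma shattersD: "shatters F A \<Longrightarrow> B \<subseteq> A \<Longrightarrow> \<exists>I\<in>F. I \<inter> A = B"
  unfolding shatters_def by simp

text \<open>Pajor's form of the Sauer-Shelah lemma. Removing \<open>u\<close> from the ground set
  splits \<open>F\<close> into \<open>F0\<close> and \<open>F1\<close>; a set shattered by either is
  shattered by \<open>F\<close>, and one shattered by both yields a second set shattered by
  \<open>F\<close>, with \<open>u\<close> added, so nothing is lost in the count.\<close>

lemma card_le_card_shattered:
  assumes "finite U" "F \<subseteq> Pow U"
  shows "card F \<le> card {A. A \<subseteq> U \<and> shatters F A}"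
  using assms
proof (induction U arbitrary: F rule: finite_induct)
  case empty
  then consider "F = {}" | "F = {{}}" by auto
  then show ?case by cases (auto simp: shatters_def conj_commute cong: conj_cong)
next
  case (insert u U)
  define F0 where "F0 = {I\<in>F. u \<notin> I}"
  define F1 where "F1 = (\<lambda>I. I - {u}) ` {I\<in>F. u \<in> I}"
  define Sh where "Sh = (\<lambda>G. {A. A \<subseteq> U \<and> shatters G A})"
  have fin: "finite (Sh G)" for G
    unfolding Sh_def by (rule finite_subset[of _ "Pow U"]) (use insert.hyps in auto)
  have finF: "finite F"
    using insert by (meson finite.insertI finite_Pow_iff finite_subset)
  have "F0 \<subseteq> Pow U" "F1 \<subseteq> Pow U"
    using insert.prems by (auto simp: F0_def F1_def)
  then have le: "card F0 \<le> card (Sh F0)" "card F1 \<le> card (Sh F1)"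
    unfolding Sh_def by (auto intro: insert.IH)
  have "card F1 = card {I\<in>F. u \<in> I}"
    unfolding F1_def by (intro card_image) (auto simp: inj_on_def)
  moreover have "F = F0 \<union> {I\<in>F. u \<in> I}" "F0 \<inter> {I\<in>F. u \<in> I} = {}"
    by (auto simp: F0_def)
  ultimately have "card F = card F0 + card F1"
    by (metis card_Un_disjoint finF finite_Un)
  \<comment> \<open>A set counted in both induction bounds lies in the intersection. Its second copy
    is traded for the set with \<open>u\<close> inserted, which differs from all members of
    \<open>Sh F0\<close> and \<open>Sh F1\<close>, as these avoid \<open>u\<close>.\<close>
  also have "\<dots> \<le> card (Sh F0 \<union> Sh F1) + card (Sh F0 \<inter> Sh F1)"
    using le card_Un_Int[OF fin fin, of F0 F1] by linarith
  also have "card (Sh F0 \<inter> Sh F1) = card (Set.insert u ` (Sh F0 \<inter> Sh F1))"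
    by (rule card_image[symmetric], rule inj_onI)
       (use insert.hyps in \<open>auto simp: Sh_def subset_iff set_eq_iff\<close>)
  also have "card (Sh F0 \<union> Sh F1) + card (Set.insert u ` (Sh F0 \<inter> Sh F1)) =
             card ((Sh F0 \<union> Sh F1) \<union> Set.insert u ` (Sh F0 \<inter> Sh F1))"
    by (rule card_Un_disjoint[symmetric]) (use fin insert.hyps in \<open>auto simp: Sh_def\<close>)
  also have "\<dots> \<le> card {A. A \<subseteq> Set.insert u U \<and> shatters F A}"
  proof (rule card_mono)
    show "finite {A. A \<subseteq> Set.insert u U \<and> shatters F A}"
      by (rule finite_subset[of _ "Pow (Set.insert u U)"]) (use insert.hyps in auto)
    have sh0: "shatters F A" if "A \<in> Sh F0" for A
      using that unfolding Sh_def F0_def shatters_def by blast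
    have sh1: "shatters F A" if A: "A \<in> Sh F1" for A
      unfolding shatters_def
    proof (intro allI impI)
      fix B assume "B \<subseteq> A"
      then obtain I where "I \<in> F1" "I \<inter> A = B"
        using A shattersD[of F1 A B] unfolding Sh_def mem_Collect_eq by blast
      then obtain I' where "I' \<in> F" "I = I' - {u}" by (auto simp: F1_def)
      moreover have "u \<notin> A" using A insert.hyps by (auto simp: Sh_def)
      ultimately show "\<exists>I\<in>F. I \<inter> A = B"
        using \<open>I \<inter> A = B\<close> by (intro bexI[of _ I']) auto
    qed
    have sh2: "shatters F (Set.insert u A)" if A: "A \<in> Sh F0 \<inter> Sh F1" for A
      unfolding shatters_def
    proof (intro allI impI)
      fix B assume B: "B \<subseteq> Set.insert u A"
      have "u \<notin> A" using A insert.hyps by (auto simp: Sh_def)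
      show "\<exists>I\<in>F. I \<inter> Set.insert u A = B"
      proof (cases "u \<in> B")
        case True
        have "B - {u} \<subseteq> A" using B by auto
        then obtain I where "I \<in> F1" "I \<inter> A = B - {u}"
          using A shattersD[of F1 A "B - {u}"] unfolding Sh_def Int_iff mem_Collect_eq by blast
        then obtain I' where "I' \<in> F" "u \<in> I'" "I = I' - {u}" by (auto simp: F1_def)
        then show ?thesis
          using \<open>I \<inter> A = B - {u}\<close> True \<open>u \<notin> A\<close> by (intro bexI[of _ I']) auto
      next
        case False
        then have "B \<subseteq> A" using B by auto
        then obtain I where "I \<in> F0" "I \<inter> A = B"
          using A shattersD[of F0 A B] unfolding Sh_def Int_iff mem_Collect_eq by blast
        then show ?thesis
          using False by (intro bexI[of _ I]) (auto simp: F0_def)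
      qed
    qed
    show "Sh F0 \<union> Sh F1 \<union> Set.insert u ` (Sh F0 \<inter> Sh F1) \<subseteq> {A. A \<subseteq> Set.insert u U \<and> shatters F A}"
      using sh0 sh1 sh2 by (auto simp: Sh_def)
  qed
  finally show ?case .
qed

text \<open>A set of size at most \<open>Suc d\<close> arises from one of size at most
  \<open>d\<close> by adding one point or nothing; \<open>None\<close> encodes the latter. This
  gives \<open>card U + 1\<close> choices per step, a crude but sufficient bound for the binomial
  sum.\<close>

lemma card_small_subsets_le:
  assumes "finite U"
  shows "card {A. A \<subseteq> U \<and> card A \<le> d} \<le> (card U + 1) ^ d"
proof (induction d)
  case 0
  have "{A. A \<subseteq> U \<and> card A \<le> 0} = {{}}"
    using assms by (auto dest: finite_subset)
  then show ?case by simp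
next
  case (Suc d)
  let ?L = "{A. A \<subseteq> U \<and> card A \<le> d}" and ?O = "Set.insert None (Some ` U)"
  let ?f = "\<lambda>(A, ob). case ob of None \<Rightarrow> A | Some u \<Rightarrow> Set.insert u A"
  have finL: "finite ?L"
    by (rule finite_subset[of _ "Pow U"]) (use assms in auto)
  have "{A. A \<subseteq> U \<and> card A \<le> Suc d} \<subseteq> ?f ` (?L \<times> ?O)"
  proof
    fix A assume A: "A \<in> {A. A \<subseteq> U \<and> card A \<le> Suc d}"
    show "A \<in> ?f ` (?L \<times> ?O)"
    proof (cases "card A \<le> d")
      case True
      then show ?thesis using A by (intro image_eqI[of _ _ "(A, None)"]) auto
    next
      case False
      then obtain u where "u \<in> A" by fastforce
      then show ?thesis
        using A False by (intro image_eqI[of _ _ "(A - {u}, Some u)"]) (auto simp: card_Diff_singleton)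
    qed
  qed
  then have "card {A. A \<subseteq> U \<and> card A \<le> Suc d} \<le> card (?L \<times> ?O)"
    using finL assms by (meson card_image_le card_mono finite_SigmaI finite_imageI finite_insert le_trans)
  also have "\<dots> = card ?L * (card U + 1)"
    using assms by (simp add: card_cartesian_product card_image)
  also have "\<dots> \<le> (card U + 1) ^ Suc d"
    unfolding power_Suc mult.commute[of "card U + 1"] by (rule mult_le_mono1[OF Suc.IH])
  finally show ?case .
qed

section \<open>Counting the traces of Euclidean balls\<close>

text \<open>Traces are sets of indices rather than of points, so coinciding sample points keep their
  multiplicity, as they do in \<open>knn_set\<close>. A negative radius gives the empty
  trace.\<close>

definition ball_traces :: "('i \<Rightarrow> 'a::metric_space) \<Rightarrow> 'i set \<Rightarrow> 'i set set" where
  "ball_traces z U = {{i\<in>U. dist x (z i) \<le> \<rho>} | x \<rho>. True}"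

text \<open>If two balls cut a finite set into complementary parts, the difference of their
  power functions is affine and separates the parts strictly; Radon's theorem forbids this as soon
  as the set has more than \<open>DIM('a) + 1\<close> points.\<close>

lemma card_shattered_by_balls_le:
  fixes z :: "'i \<Rightarrow> 'a::euclidean_space"
  assumes "finite A" "A \<subseteq> U" and sh: "shatters (ball_traces z U) A"
  shows "card A \<le> DIM('a) + 1"
proof (rule ccontr)
  assume big: "\<not> card A \<le> DIM('a) + 1"
  have cut: "\<exists>x \<rho>. \<forall>i\<in>A. dist x (z i) \<le> \<rho> \<longleftrightarrow> i \<in> B" if "B \<subseteq> A" for B
  proof -
    obtain I where "I \<in> ball_traces z U" "I \<inter> A = B"
      using shattersD[OF sh \<open>B \<subseteq> A\<close>] by blast
    then obtain x \<rho> where "{i\<in>U. dist x (z i) \<le> \<rho>} \<inter> A = B"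
      by (auto simp: ball_traces_def)
    then show ?thesis using \<open>A \<subseteq> U\<close> by (intro exI[of _ x] exI[of _ \<rho>]) auto
  qed
  \<comment> \<open>Radon's theorem concerns points, shattering concerns indices. Cutting out the
    singleton of \<open>i\<close> separates \<open>z i\<close> from every other \<open>z j\<close>,
    so passing to the image loses no element.\<close>
  have inj: "inj_on z A"
  proof (rule inj_onI)
    fix i j assume ij: "i \<in> A" "j \<in> A" "z i = z j"
    obtain x \<rho> where "\<forall>l\<in>A. dist x (z l) \<le> \<rho> \<longleftrightarrow> l \<in> {i}"
      using cut[of "{i}"] ij by auto
    then show "i = j" using ij by (metis singletonD singletonI)
  qed
  have "affine_dependent (z ` A)"
    by (rule affine_dependent_biggerset) (use big assms in \<open>auto simp: card_image[OF inj]\<close>)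
  then obtain M P where MP: "M \<inter> P = {}" "M \<union> P = z ` A" "convex hull M \<inter> convex hull P \<noteq> {}"
    using Radon_partition[of "z ` A"] assms by auto
  define B where "B = {i\<in>A. z i \<in> M}"
  obtain x1 r1 where 1: "\<forall>i\<in>A. dist x1 (z i) \<le> r1 \<longleftrightarrow> i \<in> B"
    using cut[of B] by (auto simp: B_def)
  obtain x2 r2 where 2: "\<forall>i\<in>A. dist x2 (z i) \<le> r2 \<longleftrightarrow> i \<in> A - B"
    using cut[of "A - B"] by auto
  have "M \<noteq> {}" "P \<noteq> {}" using MP(3) by auto
  have inM: "dist x1 w \<le> r1 \<and> r2 < dist x2 w" if w: "w \<in> M" for w
  proof -
    obtain i where i: "i \<in> A" "w = z i" using MP(2) w by blast
    then have "i \<in> B" using w by (auto simp: B_def)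
    then show ?thesis using 1 2 i by force
  qed
  have inP: "dist x2 w \<le> r2 \<and> r1 < dist x1 w" if w: "w \<in> P" for w
  proof -
    obtain i where i: "i \<in> A" "w = z i" using MP(2) w by blast
    then have "i \<notin> B" using w MP(1) by (auto simp: B_def)
    then show ?thesis using 1 2 i by force
  qed
  \<comment> \<open>Both balls contain a point, so their radii are nonnegative and the distance
    inequalities may be squared.\<close>
  have r: "0 \<le> r1" "0 \<le> r2"
    using inM inP \<open>M \<noteq> {}\<close> \<open>P \<noteq> {}\<close> by (meson all_not_in_conv order_trans zero_le_dist)+
  define v where "v = 2 *\<^sub>R (x2 - x1)"
  define b where "b = r1\<^sup>2 - r2\<^sup>2 - x1 \<bullet> x1 + x2 \<bullet> x2"
  have aff: "((dist x1 w)\<^sup>2 - r1\<^sup>2) - ((dist x2 w)\<^sup>2 - r2\<^sup>2) = v \<bullet> w - b" for w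
    by (simp add: dist_norm power2_norm_eq_inner v_def b_def inner_diff_left inner_diff_right
        inner_commute algebra_simps)
  have "M \<subseteq> {w. v \<bullet> w < b}"
  proof
    fix w assume "w \<in> M"
    then have "(dist x1 w)\<^sup>2 \<le> r1\<^sup>2" "r2\<^sup>2 < (dist x2 w)\<^sup>2"
      using inM r by (auto intro!: power_mono power_strict_mono)
    then show "w \<in> {w. v \<bullet> w < b}" using aff[of w] by simp
  qed
  then have "convex hull M \<subseteq> {w. v \<bullet> w < b}"
    by (intro hull_minimal convex_halfspace_lt)
  moreover have "P \<subseteq> {w. v \<bullet> w > b}"
  proof
    fix w assume "w \<in> P"
    then have "(dist x2 w)\<^sup>2 \<le> r2\<^sup>2" "r1\<^sup>2 < (dist x1 w)\<^sup>2"
      using inP r by (auto intro!: power_mono power_strict_mono)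
    then show "w \<in> {w. v \<bullet> w > b}" using aff[of w] by simp
  qed
  then have "convex hull P \<subseteq> {w. v \<bullet> w > b}"
    by (intro hull_minimal convex_halfspace_gt)
  ultimately show False using MP(3) by fastforce
qed

lemma card_ball_traces_le:
  fixes z :: "'i \<Rightarrow> 'a::euclidean_space"
  assumes "finite U"
  shows "card (ball_traces z U) \<le> (card U + 1) ^ (DIM('a) + 1)"
proof -
  have "card (ball_traces z U) \<le> card {A. A \<subseteq> U \<and> shatters (ball_traces z U) A}"
    by (rule card_le_card_shattered) (use assms in \<open>auto simp: ball_traces_def\<close>)
  also have "\<dots> \<le> card {A. A \<subseteq> U \<and> card A \<le> DIM('a) + 1}"
  proof (rule card_mono)
    show "finite {A. A \<subseteq> U \<and> card A \<le> DIM('a) + 1}"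
      by (rule finite_subset[of _ "Pow U"]) (use assms in auto)
    show "{A. A \<subseteq> U \<and> shatters (ball_traces z U) A} \<subseteq> {A. A \<subseteq> U \<and> card A \<le> DIM('a) + 1}"
      using card_shattered_by_balls_le[of _ U z] finite_subset[OF _ assms] by blast
  qed
  also have "\<dots> \<le> (card U + 1) ^ (DIM('a) + 1)"
    by (rule card_small_subsets_le[OF assms])
  finally show ?thesis .
qed

text \<open>Enlarging the radius slightly turns all defining conditions into strict inequalities, so the
  centre and the radius may be moved into countable dense sets.\<close>

lemma ball_traces_dense:
  fixes z :: "'i \<Rightarrow> 'a::euclidean_space"
  assumes "finite U" and dense: "\<And>T. open T \<Longrightarrow> T \<noteq> {} \<Longrightarrow> \<exists>d\<in>Q. d \<in> T"
  shows "I \<in> ball_traces z U \<longleftrightarrow>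
    (\<exists>x\<in>Q. \<exists>\<rho>\<in>\<rat>. I \<subseteq> U \<and> (\<forall>i\<in>U. dist x (z i) \<le> \<rho> \<longleftrightarrow> i \<in> I))"
proof
  assume "I \<in> ball_traces z U"
  then obtain x0 r0 where I: "I = {i\<in>U. dist x0 (z i) \<le> r0}" by (auto simp: ball_traces_def)
  obtain \<rho> where \<rho>: "\<rho> \<in> \<rat>" "r0 < \<rho>" "\<And>i. i \<in> U \<Longrightarrow> i \<notin> I \<Longrightarrow> \<rho> < dist x0 (z i)"
  proof -
    have "\<exists>b>r0. \<forall>i\<in>U - I. b \<le> dist x0 (z i)"
    proof (cases "U - I = {}")
      case True
      then show ?thesis by (intro exI[of _ "r0 + 1"]) auto
    next
      case False
      then show ?thesis
        using assms(1) I by (intro exI[of _ "Min ((\<lambda>i. dist x0 (z i)) ` (U - I))"]) auto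
    qed
    then obtain b where "b > r0" "\<forall>i\<in>U - I. b \<le> dist x0 (z i)" by auto
    then show thesis using Rats_dense_in_real[of r0 b] that by force
  qed
  define T where "T = (\<Inter>i\<in>I. {x. dist x (z i) < \<rho>}) \<inter> (\<Inter>i\<in>U - I. {x. \<rho> < dist x (z i)})"
  have "finite I" using I assms(1) by auto
  then have "open T"
    unfolding T_def using assms(1)
    by (intro open_Int open_INT ballI open_Collect_less continuous_intros) auto
  moreover have "x0 \<in> T" using \<rho> by (auto simp: T_def I)
  ultimately obtain x where "x \<in> Q" "x \<in> T" using dense by blast
  then have "\<forall>i\<in>U. dist x (z i) \<le> \<rho> \<longleftrightarrow> i \<in> I" by (force simp: T_def)
  then show "\<exists>x\<in>Q. \<exists>\<rho>\<in>\<rat>. I \<subseteq> U \<and> (\<forall>i\<in>U. dist x (z i) \<le> \<rho> \<longleftrightarrow> i \<in> I)"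
    using \<open>x \<in> Q\<close> \<rho>(1) I by blast
next
  assume "\<exists>x\<in>Q. \<exists>\<rho>\<in>\<rat>. I \<subseteq> U \<and> (\<forall>i\<in>U. dist x (z i) \<le> \<rho> \<longleftrightarrow> i \<in> I)"
  then obtain x \<rho> where "I \<subseteq> U" "\<forall>i\<in>U. dist x (z i) \<le> \<rho> \<longleftrightarrow> i \<in> I" by auto
  then have "I = {i\<in>U. dist x (z i) \<le> \<rho>}" by auto
  then show "I \<in> ball_traces z U" by (auto simp: ball_traces_def)
qed

section \<open>Nearest neighbour sets\<close>

text \<open>The radius is an infimum, and the point is that it is attained: if the ball of that
  radius held fewer than \<open>k\<close> points, any radius with \<open>k\<close> points would have
  to reach the next larger sample distance, which pushes the infimum strictly up.\<close>

lemma knn_set_properties: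
  assumes "1 \<le> k" and "k \<le> knn_count S n x r"
  shows knn_radius_le: "knn_radius S n k x \<le> r"
    and card_knn_set_ge: "k \<le> card (knn_set S n k x)"
proof -
  let ?W = "{r. k \<le> knn_count S n x r}"
  let ?R = "knn_radius S n k x"
  \<comment> \<open>As \<open>k\<close> is positive and a ball of negative radius is empty, the
    infimum is taken over a set bounded below by 0 and is not a junk value.\<close>
  have "0 \<le> w" if "w \<in> ?W" for w
  proof (rule ccontr)
    assume "\<not> 0 \<le> w"
    then have "{i \<in> {..<n}. dist x (fst (S i)) \<le> w} = {}"
      by (auto simp: not_le intro: less_le_trans)
    then have "knn_count S n x w = 0" unfolding knn_count_def by (simp only: card.empty)
    then show False using that assms(1) by simp
  qed
  then have bdd: "bdd_below ?W" by (rule bdd_belowI)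
  show "?R \<le> r"
    unfolding knn_radius_def by (rule cInf_lower[OF _ bdd]) (use assms in simp)
  show "k \<le> card (knn_set S n k x)"
  proof (rule ccontr)
    assume "\<not> k \<le> card (knn_set S n k x)"
    then have less: "knn_count S n x ?R < k" by (simp add: knn_count_def knn_set_def)
    define T where "T = (\<lambda>i. dist x (fst (S i))) ` {i. i < n \<and> ?R < dist x (fst (S i))}"
    have "finite T" by (simp add: T_def)
    have ex: "\<exists>d\<in>T. d \<le> w" if "w \<in> ?W" for w
    proof (rule ccontr)
      assume "\<not> (\<exists>d\<in>T. d \<le> w)"
      then have "{i \<in> {..<n}. dist x (fst (S i)) \<le> w} \<subseteq> {i \<in> {..<n}. dist x (fst (S i)) \<le> ?R}"
        by (force simp: T_def)
      then have "knn_count S n x w \<le> knn_count S n x ?R"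
        unfolding knn_count_def by (intro card_mono) auto
      then show False using that less by simp
    qed
    have "Min T \<le> Inf ?W"
    proof (rule cInf_greatest)
      show "?W \<noteq> {}" using assms by blast
      show "Min T \<le> w" if "w \<in> ?W" for w
        using ex[OF that] \<open>finite T\<close> by (meson Min_le order_trans)
    qed
    \<comment> \<open>\<open>T\<close> is nonempty because \<open>r\<close> itself is an admissible
      radius; otherwise \<open>Min T\<close> would be meaningless.\<close>
    moreover have "?R < Min T"
      using ex[of r] assms \<open>finite T\<close> by (subst Min_gr_iff) (auto simp: T_def)
    ultimately show False by (simp add: knn_radius_def)
  qed
qed

text \<open>This puts the neighbour sets of all centres \<open>x\<close> at once into a family of
  size polynomial in \<open>n\<close>.\<close>

lemma knn_set_in_ball_traces: "knn_set S n k x \<in> ball_traces (\<lambda>i. fst (S i)) {..<n}"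
  by (auto simp: knn_set_def ball_traces_def)

text \<open>Bias-variance split: the error is the average label noise over the neighbours plus the
  average change of \<open>eta\<close> from \<open>x\<close> to them. The first is bounded by
  \<open>dev\<close>; the second is controlled because every neighbour lies within
  \<open>r\<close>.\<close>

lemma knn_label_error_le:
  fixes t :: real
  assumes eta: "\<And>x x'. x \<in> X \<Longrightarrow> x' \<in> X \<Longrightarrow> \<bar>eta x - eta x'\<bar> \<le> C * dist x x' powr \<alpha>"
    and "0 < C" "0 < \<alpha>" "1 \<le> k" "x \<in> X"
    and SX: "\<And>i. i < n \<Longrightarrow> fst (S i) \<in> X"
    and count: "k \<le> knn_count S n x r"
    and dev: "\<bar>\<Sum>i\<in>knn_set S n k x. of_bool (snd (S i)) - eta (fst (S i))\<bar>
                \<le> t * card (knn_set S n k x)"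
  shows "\<bar>knn_label S n k x - eta x\<bar> \<le> C * r powr \<alpha> + t"
proof -
  let ?N = "knn_set S n k x"
  have N: "0 < card ?N" using card_knn_set_ge[OF \<open>1 \<le> k\<close> count] \<open>1 \<le> k\<close> by simp
  have bias: "\<bar>\<Sum>i\<in>?N. eta (fst (S i)) - eta x\<bar> \<le> card ?N * (C * r powr \<alpha>)"
  proof -
    have "\<bar>eta (fst (S i)) - eta x\<bar> \<le> C * r powr \<alpha>" if "i \<in> ?N" for i
    proof -
      have i: "i < n" "dist x (fst (S i)) \<le> r"
        using that knn_radius_le[OF \<open>1 \<le> k\<close> count] by (auto simp: knn_set_def)
      have "\<bar>eta (fst (S i)) - eta x\<bar> \<le> C * dist (fst (S i)) x powr \<alpha>"
        using eta SX i \<open>x \<in> X\<close> by blast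
      also have "\<dots> \<le> C * r powr \<alpha>"
        using i assms by (intro mult_left_mono powr_mono2) (auto simp: dist_commute)
      finally show ?thesis .
    qed
    then show ?thesis
      by (intro order_trans[OF sum_abs] sum_bounded_above)
  qed
  have "knn_label S n k x - eta x =
      ((\<Sum>i\<in>?N. of_bool (snd (S i)) - eta (fst (S i))) + (\<Sum>i\<in>?N. eta (fst (S i)) - eta x)) / card ?N"
    using N by (simp add: knn_label_def of_bool_def sum_subtractf field_simps)
  also have "\<bar>\<dots>\<bar> \<le> (t * card ?N + card ?N * (C * r powr \<alpha>)) / card ?N"
    unfolding abs_divide using bias dev by (auto intro!: divide_right_mono)
  also have "\<dots> = C * r powr \<alpha> + t" using N by (simp add: field_simps)
  finally show ?thesis .
qed

section \<open>Concentration for the sample\<close>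

text \<open>Hoeffding's lemma for a centred Bernoulli variable. For negative \<open>l\<close>,
  exchanging the two outcomes turns \<open>q\<close> into \<open>1 - q\<close> and \<open>l\<close>
  into \<open>- l\<close>.\<close>

lemma bernoulli_mgf_le:
  fixes q l :: real
  assumes "0 \<le> q" "q \<le> 1"
  shows "q * exp (l * (1 - q)) + (1 - q) * exp (l * (0 - q)) \<le> exp (l\<^sup>2 / 8)"
proof -
  have *: "q * exp (l * (1 - q)) + (1 - q) * exp (l * (0 - q)) \<le> exp (l\<^sup>2 / 8)"
    if "0 \<le> l" "0 \<le> q" "q \<le> 1" for q l :: real
  proof -
    have "0 < 1 + q * (exp l - 1)" using that by (intro add_pos_nonneg mult_nonneg_nonneg) auto
    then have "exp (- l * q + ln (1 + q * (exp l - 1))) = exp (- l * q) * (1 + q * (exp l - 1))"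
      unfolding exp_add by simp
    also have "\<dots> = q * exp (l * (1 - q)) + (1 - q) * exp (l * (0 - q))"
      by (simp add: algebra_simps exp_diff exp_minus exp_add field_simps)
    finally show ?thesis
      using Hoeffdings_lemma_aux[of l q] that by (metis exp_le_cancel_iff)
  qed
  show ?thesis
  proof (cases "0 \<le> l")
    case True
    then show ?thesis using * assms by blast
  next
    case False
    then show ?thesis using *[of "- l" "1 - q"] assms by (simp add: algebra_simps)
  qed
qed

section \<open>The statistical model and the law of one labelled point\<close>

text \<open>Only what the concentration bounds need is assumed here; smoothness and support
  regularity enter in the final theorem. Measurability of the label function is asked for on
  \<open>X\<close> alone.\<close>

locale classification_model =
  fixes X :: "'a::euclidean_space set" and p eta :: "'a \<Rightarrow> real"
  assumes X_borel [measurable]: "X \<in> sets borel"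
    and p_measurable [measurable]: "p \<in> borel_measurable borel"
    and p_nonneg: "0 \<le> p x"
    and p_support: "x \<notin> X \<Longrightarrow> p x = 0"
    and p_integral: "(\<integral>\<^sup>+ x. ennreal (p x) \<partial>lborel) = 1"
    and eta_range: "x \<in> X \<Longrightarrow> 0 \<le> eta x \<and> eta x \<le> 1"
    and eta_measurable: "(\<lambda>x. indicator X x * eta x) \<in> borel_measurable borel"
begin

text \<open>Outside \<open>X\<close> the label function is arbitrary, possibly non-measurable.\<close>

definition eta0 :: "'a \<Rightarrow> real" where "eta0 x = indicator X x * eta x"

lemma eta0_measurable [measurable]: "eta0 \<in> borel_measurable borel"
  using eta_measurable by (simp add: eta0_def[abs_def])

lemma eta0_range: "0 \<le> eta0 x" "eta0 x \<le> 1"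
  using eta_range[of x] by (auto simp: eta0_def indicator_def)

abbreviation M :: "('a \<times> bool) measure" where "M \<equiv> pair_dist X p eta"
abbreviation P :: "nat set \<Rightarrow> (nat \<Rightarrow> 'a \<times> bool) measure" where "P J \<equiv> PiM J (\<lambda>_. M)"

lemma sets_M [measurable_cong]: "sets M = sets (borel \<Otimes>\<^sub>M count_space UNIV)"
  unfolding pair_dist_def sets_density by (rule sets_pair_measure_cong) simp_all

lemma space_M [simp]: "space M = UNIV"
  using sets_eq_imp_space_eq[OF sets_M] by (simp add: space_pair_measure)

lemma M_eq_density:
  "M = density (lborel \<Otimes>\<^sub>M count_space UNIV)
         (\<lambda>z. ennreal (p (fst z) * (if snd z then eta0 (fst z) else 1 - eta0 (fst z))))"
  unfolding pair_dist_def
  by (intro arg_cong2[where f = density] ext) (auto simp: eta0_def indicator_def p_support)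

lemma nn_integral_M:
  assumes [measurable]: "f \<in> borel_measurable (borel \<Otimes>\<^sub>M count_space UNIV)"
  shows "(\<integral>\<^sup>+ z. f z \<partial>M) = (\<integral>\<^sup>+ x. ennreal (p x) *
           (ennreal (eta0 x) * f (x, True) + ennreal (1 - eta0 x) * f (x, False)) \<partial>lborel)"
proof -
  interpret C: sigma_finite_measure "count_space (UNIV :: bool set)"
    by (rule sigma_finite_measure_count_space_finite) simp
  let ?w = "\<lambda>z. ennreal (p (fst z) * (if snd z then eta0 (fst z) else 1 - eta0 (fst z)))"
  have [measurable]: "f \<in> borel_measurable (lborel \<Otimes>\<^sub>M count_space UNIV)"
    using assms by (simp cong: measurable_cong_sets sets_pair_measure_cong)
  have [measurable]: "?w \<in> borel_measurable (lborel \<Otimes>\<^sub>M count_space UNIV)"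
    by measurable
  have "(\<integral>\<^sup>+ z. f z \<partial>M) = (\<integral>\<^sup>+ z. ?w z * f z \<partial>(lborel \<Otimes>\<^sub>M count_space UNIV))"
    unfolding M_eq_density by (rule nn_integral_density) measurable
  also have "\<dots> = (\<integral>\<^sup>+ x. \<integral>\<^sup>+ b. ?w (x, b) * f (x, b) \<partial>count_space UNIV \<partial>lborel)"
    by (rule C.nn_integral_fst[symmetric]) measurable
  also have "\<dots> = (\<integral>\<^sup>+ x. ennreal (p x) *
           (ennreal (eta0 x) * f (x, True) + ennreal (1 - eta0 x) * f (x, False)) \<partial>lborel)"
    by (intro nn_integral_cong)
       (simp add: nn_integral_count_space_finite UNIV_bool ennreal_mult p_nonneg eta0_range
         distrib_left mult_ac add_ac)
  finally show ?thesis .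
qed

lemma eta0_weights: "ennreal (eta0 x) * c + ennreal (1 - eta0 x) * c = c"
proof -
  have "ennreal (eta0 x) + ennreal (1 - eta0 x) = 1"
    using eta0_range[of x] by (simp add: ennreal_plus[symmetric] del: ennreal_plus)
  then show ?thesis by (metis distrib_right mult_1)
qed

lemma nn_integral_M_fst:
  assumes [measurable]: "g \<in> borel_measurable borel"
  shows "(\<integral>\<^sup>+ z. g (fst z) \<partial>M) = (\<integral>\<^sup>+ x. ennreal (p x) * g x \<partial>lborel)"
  by (subst nn_integral_M) (simp_all add: eta0_weights)

lemma prob_space_M: "prob_space M"
proof
  have "emeasure M (space M) = (\<integral>\<^sup>+ z. 1 \<partial>M)" by simp
  also have "\<dots> = 1"
    by (subst nn_integral_M_fst[of "\<lambda>_. 1"]) (simp_all add: p_integral)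
  finally show "emeasure M (space M) = 1" .
qed

sublocale M: prob_space M by (rule prob_space_M)
sublocale PM: product_prob_space "\<lambda>_::nat. M" UNIV ..

lemma prob_space_P: "prob_space (P J)"
  by (intro prob_space_PiM prob_space_M)

lemma component_measurable:
  assumes "i \<in> J"
  shows "(\<lambda>S. S i) \<in> measurable (P J) (borel \<Otimes>\<^sub>M count_space UNIV)"
  using measurable_component_singleton[of i J "\<lambda>_. M"] assms
  by (simp add: measurable_cong_sets[OF refl sets_M])

lemma fst_component_measurable:
  assumes "i \<in> J"
  shows "(\<lambda>S. fst (S i)) \<in> borel_measurable (P J)"
  by (rule measurable_compose[OF component_measurable[OF assms] measurable_fst])

section \<open>Hoeffding's inequality with the labels integrated out\<close>

text \<open>Fubini isolates coordinate \<open>i\<close>. By \<open>inv\<close> the factor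
  \<open>G\<close> does not see its label, so for a fixed point the label average falls on
  \<open>h\<close> alone and is at most \<open>c\<close>. This does the work of conditioning on the
  sample points.\<close>

lemma nn_integral_label_step:
  assumes "finite J" "i \<in> J"
    and G [measurable]: "G \<in> borel_measurable (P J)"
    and inv: "\<And>S x. G (S(i := (x, True))) = G (S(i := (x, False)))"
    and h [measurable]: "h \<in> borel_measurable (borel \<Otimes>\<^sub>M count_space UNIV)"
    and le: "\<And>x. ennreal (eta0 x) * h (x, True) + ennreal (1 - eta0 x) * h (x, False) \<le> c"
  shows "(\<integral>\<^sup>+ S. G S * h (S i) \<partial>P J) \<le> c * (\<integral>\<^sup>+ S. G S \<partial>P J)"
proof -
  define J' where "J' = J - {i}"
  have J: "J = insert i J'" "i \<notin> J'" "finite J'" using assms by (auto simp: J'_def)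
  have [measurable]: "G \<in> borel_measurable (P (insert i J'))" using G J by simp
  have "(\<integral>\<^sup>+ S. G S * h (S i) \<partial>P J) = (\<integral>\<^sup>+ S. \<integral>\<^sup>+ z. G (S(i := z)) * h z \<partial>M \<partial>P J')"
    unfolding J(1) by (subst PM.product_nn_integral_insert) (use J in simp_all)
  also have "\<dots> \<le> (\<integral>\<^sup>+ S. c * (\<integral>\<^sup>+ z. G (S(i := z)) \<partial>M) \<partial>P J')"
  proof (rule nn_integral_mono)
    fix S assume [measurable]: "S \<in> space (P J')"
    have "(\<lambda>z. S(i := z)) \<in> measurable M (P (insert i J'))"
      by (rule measurable_fun_upd[where J = J']) auto
    then have "(\<lambda>z. G (S(i := z))) \<in> borel_measurable M" by measurable
    then have Gm [measurable]: "(\<lambda>z. G (S(i := z))) \<in> borel_measurable (borel \<Otimes>\<^sub>M count_space UNIV)"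
      by (simp cong: measurable_cong_sets add: measurable_cong_sets[OF sets_M refl])
    have "(\<integral>\<^sup>+ z. G (S(i := z)) * h z \<partial>M) =
        (\<integral>\<^sup>+ x. ennreal (p x) * (G (S(i := (x, True))) *
          (ennreal (eta0 x) * h (x, True) + ennreal (1 - eta0 x) * h (x, False))) \<partial>lborel)"
      by (subst nn_integral_M) (auto simp: inv distrib_left mult_ac intro!: nn_integral_cong)
    also have "\<dots> \<le> (\<integral>\<^sup>+ x. c * (ennreal (p x) * G (S(i := (x, True)))) \<partial>lborel)"
    proof (intro nn_integral_mono)
      fix x
      show "ennreal (p x) * (G (S(i := (x, True))) *
          (ennreal (eta0 x) * h (x, True) + ennreal (1 - eta0 x) * h (x, False)))
          \<le> c * (ennreal (p x) * G (S(i := (x, True))))"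
        unfolding mult.assoc[symmetric] mult.commute[of c]
        using mult_left_mono[OF le, of "ennreal (p x) * G (S(i := (x, True)))"] by (simp add: mult_ac)
    qed
    also have "\<dots> = c * (\<integral>\<^sup>+ x. ennreal (p x) * G (S(i := (x, True))) \<partial>lborel)"
    proof (rule nn_integral_cmult)
      have "(\<lambda>x. G (S(i := (x, True)))) \<in> borel_measurable borel"
        by (rule measurable_compose[OF _ Gm]) measurable
      then show "(\<lambda>x. ennreal (p x) * G (S(i := (x, True)))) \<in> borel_measurable lborel"
        by simp
    qed
    also have "(\<integral>\<^sup>+ x. ennreal (p x) * G (S(i := (x, True))) \<partial>lborel) = (\<integral>\<^sup>+ z. G (S(i := z)) \<partial>M)"
      by (subst nn_integral_M) (simp_all add: inv eta0_weights)
    finally show "(\<integral>\<^sup>+ z. G (S(i := z)) * h z \<partial>M) \<le> c * (\<integral>\<^sup>+ z. G (S(i := z)) \<partial>M)" .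
  qed
  also have "\<dots> = c * (\<integral>\<^sup>+ S. \<integral>\<^sup>+ z. G (S(i := z)) \<partial>M \<partial>P J')"
    by (rule nn_integral_cmult) measurable
  also have "(\<integral>\<^sup>+ S. \<integral>\<^sup>+ z. G (S(i := z)) \<partial>M \<partial>P J') = (\<integral>\<^sup>+ S. G S \<partial>P J)"
    unfolding J(1) by (subst PM.product_nn_integral_insert) (use J in simp_all)
  finally show ?thesis .
qed

text \<open>Induction over \<open>I\<close>: when coordinate \<open>i\<close> is treated, the
  factors of the other coordinates join \<open>G\<close>, since they do not read the label at
  \<open>i\<close>.\<close>

lemma nn_integral_label_prod:
  assumes J: "finite J" "I \<subseteq> J"
    and G [measurable]: "G \<in> borel_measurable (P J)"
    and inv: "\<And>S i x. i \<in> J \<Longrightarrow> G (S(i := (x, True))) = G (S(i := (x, False)))"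
    and h [measurable]: "h \<in> borel_measurable (borel \<Otimes>\<^sub>M count_space UNIV)"
    and le: "\<And>x. ennreal (eta0 x) * h (x, True) + ennreal (1 - eta0 x) * h (x, False) \<le> c"
  shows "(\<integral>\<^sup>+ S. G S * (\<Prod>i\<in>I. h (S i)) \<partial>P J) \<le> c ^ card I * (\<integral>\<^sup>+ S. G S \<partial>P J)"
proof -
  have "finite I" using J finite_subset by blast
  from this J(2) show ?thesis
  proof (induction I rule: finite_induct)
    case (insert i I)
    have hm: "(\<lambda>S. h (S j)) \<in> borel_measurable (P J)" if "j \<in> J" for j
      using that by (intro measurable_compose[OF measurable_component_singleton]) measurable
    have [measurable]: "(\<lambda>S. \<Prod>i\<in>I. h (S i)) \<in> borel_measurable (P J)"
      using insert.prems by (intro borel_measurable_prod_ennreal hm) auto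
    have "(\<integral>\<^sup>+ S. G S * (\<Prod>j\<in>Set.insert i I. h (S j)) \<partial>P J) =
          (\<integral>\<^sup>+ S. (G S * (\<Prod>j\<in>I. h (S j))) * h (S i) \<partial>P J)"
      using insert.hyps by (simp add: mult_ac)
    also have "\<dots> \<le> c * (\<integral>\<^sup>+ S. G S * (\<Prod>j\<in>I. h (S j)) \<partial>P J)"
    proof (rule nn_integral_label_step)
      show "(\<lambda>S. G S * (\<Prod>j\<in>I. h (S j))) \<in> borel_measurable (P J)" by measurable
      show "G (S(i := (x, True))) * (\<Prod>j\<in>I. h ((S(i := (x, True))) j)) =
            G (S(i := (x, False))) * (\<Prod>j\<in>I. h ((S(i := (x, False))) j))" for S x
        using insert.hyps insert.prems by (intro arg_cong2[where f = times] inv prod.cong) auto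
    qed (use J(1) insert.prems le in auto)
    also have "\<dots> \<le> c * (c ^ card I * (\<integral>\<^sup>+ S. G S \<partial>P J))"
      using insert by (intro mult_left_mono) auto
    finally show ?case using insert.hyps by (simp add: mult_ac)
  qed simp
qed

text \<open>Hoeffding's inequality restricted to an event \<open>A\<close> that, by
  \<open>inv\<close>, is decided by the points and not by the labels. Keeping the factor
  \<open>emeasure (P J) A\<close> is what later allows summation over random traces.\<close>

lemma emeasure_deviation_le:
  fixes t :: real
  assumes J: "finite J" "I \<subseteq> J" "0 < t"
    and A [measurable]: "A \<in> sets (P J)"
    and inv: "\<And>S i x. i \<in> J \<Longrightarrow> S(i := (x, True)) \<in> A \<longleftrightarrow> S(i := (x, False)) \<in> A"
  shows "emeasure (P J) {S \<in> space (P J). S \<in> A \<and>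
            t * card I < \<bar>\<Sum>i\<in>I. of_bool (snd (S i)) - eta0 (fst (S i))\<bar>}
          \<le> ennreal (2 * exp (- 2 * t\<^sup>2 * card I)) * emeasure (P J) A"
proof -
  let ?d = "\<lambda>S. \<Sum>i\<in>I. of_bool (snd (S i)) - eta0 (fst (S i)) :: real"
  have "finite I" using J finite_subset by blast
  have tm: "(\<lambda>S. of_bool (snd (S i)) - eta0 (fst (S i)) :: real) \<in> borel_measurable (P J)"
    if "i \<in> I" for i
  proof -
    have "i \<in> J" using that J by auto
    note [measurable] = component_measurable[OF this]
    show ?thesis by measurable
  qed
  have dm [measurable]: "?d \<in> borel_measurable (P J)"
    by (intro borel_measurable_sum tm)
  have one_sided: "emeasure (P J) {S \<in> space (P J). S \<in> A \<and> t * card I < s * ?d S}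
      \<le> ennreal (exp (- 2 * t\<^sup>2 * card I)) * emeasure (P J) A" if s: "s = 1 \<or> s = -1" for s :: real
  proof -
    \<comment> \<open>\<open>s\<close> selects the tail. The parameter \<open>4 * t\<close>
      minimises \<open>l\<^sup>2 / 8 - l * t\<close> over \<open>l\<close>, with minimum
      \<open>- 2 * t\<^sup>2\<close> for each index.\<close>
    define h where "h = (\<lambda>z. ennreal (exp (4 * t * s * (of_bool (snd z) - eta0 (fst z)))))"
    have [measurable]: "h \<in> borel_measurable (borel \<Otimes>\<^sub>M count_space UNIV)"
      unfolding h_def by measurable
    have ss: "s\<^sup>2 = 1" using s by auto
    have hle: "ennreal (eta0 x) * h (x, True) + ennreal (1 - eta0 x) * h (x, False)
                 \<le> ennreal (exp (2 * t\<^sup>2))" for x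
      using bernoulli_mgf_le[OF eta0_range, of x "4 * t * s"] eta0_range[of x]
      by (simp add: h_def ennreal_mult[symmetric] ennreal_plus[symmetric] power_mult_distrib ss
          del: ennreal_plus)
    have prodh: "(\<Prod>i\<in>I. h (S i)) = ennreal (exp (4 * t * s * ?d S))" for S
      using \<open>finite I\<close> by (simp add: h_def prod_ennreal exp_sum sum_distrib_left)
    \<comment> \<open>The Markov factor \<open>exp (- l * t * card I)\<close> at
      \<open>l = 4 * t\<close>.\<close>
    let ?K = "ennreal (exp (- 4 * t\<^sup>2 * card I))"
    have "emeasure (P J) {S \<in> space (P J). S \<in> A \<and> t * card I < s * ?d S} =
          (\<integral>\<^sup>+ S. indicator {S \<in> space (P J). S \<in> A \<and> t * card I < s * ?d S} S \<partial>P J)"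
      by (rule nn_integral_indicator[symmetric]) measurable
    also have "\<dots> \<le> (\<integral>\<^sup>+ S. ?K * (indicator A S * (\<Prod>i\<in>I. h (S i))) \<partial>P J)"
    proof (intro nn_integral_mono)
      fix S
      show "indicator {S \<in> space (P J). S \<in> A \<and> t * card I < s * ?d S} S
              \<le> ?K * (indicator A S * (\<Prod>i\<in>I. h (S i)))"
      proof (cases "S \<in> A \<and> t * card I < s * ?d S")
        case True
        have "4 * t * (t * card I) \<le> 4 * t * (s * ?d S)"
          using True \<open>0 < t\<close> by (intro mult_left_mono) auto
        then have "1 \<le> exp (- 4 * t\<^sup>2 * card I + 4 * t * s * ?d S)"
          by (simp add: power2_eq_square mult_ac)
        then have "1 \<le> ennreal (exp (- 4 * t\<^sup>2 * card I) * exp (4 * t * s * ?d S))"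
          unfolding exp_add by simp
        then have "1 \<le> ?K * ennreal (exp (4 * t * s * ?d S))"
          by (simp add: ennreal_mult)
        then show ?thesis using True unfolding prodh by (simp add: indicator_def)
      qed (auto simp: indicator_def)
    qed
    also have "\<dots> = ?K * (\<integral>\<^sup>+ S. indicator A S * (\<Prod>i\<in>I. h (S i)) \<partial>P J)"
      unfolding prodh by (rule nn_integral_cmult) measurable
    also have "\<dots> \<le> ?K * (ennreal (exp (2 * t\<^sup>2)) ^ card I * (\<integral>\<^sup>+ S. indicator A S \<partial>P J))"
      by (intro mult_left_mono nn_integral_label_prod J hle)
         (use inv in \<open>auto simp: indicator_def\<close>)
    also have "\<dots> = (?K * ennreal (exp (2 * t\<^sup>2)) ^ card I) * emeasure (P J) A"
      by (simp add: mult_ac)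
    also have "?K * ennreal (exp (2 * t\<^sup>2)) ^ card I = ennreal (exp (- 2 * t\<^sup>2 * card I))"
      by (simp add: ennreal_power ennreal_mult[symmetric] exp_of_nat_mult[symmetric] exp_add[symmetric]
          algebra_simps)
    finally show ?thesis .
  qed
  have "emeasure (P J) {S \<in> space (P J). S \<in> A \<and> t * card I < \<bar>?d S\<bar>} \<le>
        emeasure (P J) ({S \<in> space (P J). S \<in> A \<and> t * card I < 1 * ?d S} \<union>
                        {S \<in> space (P J). S \<in> A \<and> t * card I < (-1) * ?d S})"
    by (rule emeasure_mono) auto
  also have "\<dots> \<le> emeasure (P J) {S \<in> space (P J). S \<in> A \<and> t * card I < 1 * ?d S} +
                  emeasure (P J) {S \<in> space (P J). S \<in> A \<and> t * card I < (-1) * ?d S}"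
    by (rule emeasure_subadditive) measurable
  also have "\<dots> \<le> ennreal (exp (- 2 * t\<^sup>2 * card I)) * emeasure (P J) A +
                  ennreal (exp (- 2 * t\<^sup>2 * card I)) * emeasure (P J) A"
    by (intro add_mono one_sided) auto
  also have "\<dots> = ennreal (2 * exp (- 2 * t\<^sup>2 * card I)) * emeasure (P J) A"
    by (simp add: ennreal_mult mult_2[symmetric] mult_ac)
  finally show ?thesis .
qed

text \<open>The event is a union over uncountably many centres and radii; by
  \<open>ball_traces_dense\<close>, a countable dense set of centres and the rational radii
  suffice.\<close>

lemma ball_traces_event:
  "{S \<in> space (P {..<n}). I \<in> ball_traces (\<lambda>i. fst (S i)) {..<n}} \<in> sets (P {..<n})"
proof -
  obtain Q :: "'a set" where Q: "countable Q" "\<And>T. open T \<Longrightarrow> T \<noteq> {} \<Longrightarrow> \<exists>d\<in>Q. d \<in> T"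
    using countable_dense_setE by blast
  let ?R = "\<lambda>x \<rho>. {S \<in> space (P {..<n}). I \<subseteq> {..<n} \<and> (\<forall>i\<in>{..<n}. dist x (fst (S i)) \<le> \<rho> \<longleftrightarrow> i \<in> I)}"
  have R: "?R x \<rho> \<in> sets (P {..<n})" for x \<rho>
  proof (intro sets.sets_Collect_conj sets.sets_Collect_const sets.sets_Collect_finite_All)
    fix i assume "i \<in> {..<n}"
    note [measurable] = fst_component_measurable[OF this]
    show "{S \<in> space (P {..<n}). dist x (fst (S i)) \<le> \<rho> \<longleftrightarrow> i \<in> I} \<in> sets (P {..<n})"
      by measurable
  qed simp
  have "{S \<in> space (P {..<n}). I \<in> ball_traces (\<lambda>i. fst (S i)) {..<n}} = (\<Union>x\<in>Q. \<Union>\<rho>\<in>\<rat>. ?R x \<rho>)"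
    by (subst ball_traces_dense[OF _ Q(2)]) auto
  also have "\<dots> \<in> sets (P {..<n})"
    using Q(1) countable_rat R by (intro sets.countable_UN'') auto
  finally show ?thesis .
qed

text \<open>Union bound over all index sets of size at least \<open>k\<close>, each weighted by the
  probability that it occurs as a trace. These probabilities add up to at most the expected number
  of traces, which is polynomial in \<open>n\<close>, although \<open>W\<close> may be exponentially
  large.\<close>

lemma emeasure_trace_deviation_le:
  fixes t :: real and n k :: nat
  assumes t: "0 < t"
  defines "dev \<equiv> \<lambda>S I. \<bar>\<Sum>i\<in>I. of_bool (snd (S i)) - eta0 (fst (S i))\<bar>"
  defines "B \<equiv> {S \<in> space (P {..<n}). \<exists>I\<in>ball_traces (\<lambda>i. fst (S i)) {..<n}. k \<le> card I \<and> t * card I < dev S I}"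
  shows "B \<in> sets (P {..<n})"
    and "emeasure (P {..<n}) B \<le> ennreal (2 * exp (- 2 * t\<^sup>2 * k) * (real n + 1) ^ (DIM('a) + 1))"
proof -
  define A where "A = (\<lambda>I. {S \<in> space (P {..<n}). I \<in> ball_traces (\<lambda>i. fst (S i)) {..<n}})"
  define W where "W = {I. I \<subseteq> {..<n} \<and> k \<le> card I}"
  have A [measurable]: "A I \<in> sets (P {..<n})" for I
    unfolding A_def by (rule ball_traces_event)
  have finW: "finite W" unfolding W_def by (rule finite_subset[of _ "Pow {..<n}"]) auto
  let ?E = "\<lambda>I. {S \<in> space (P {..<n}). S \<in> A I \<and> t * card I < dev S I}"
  have tr: "I \<subseteq> {..<n}" if "I \<in> ball_traces z {..<n}" for I and z :: "nat \<Rightarrow> 'a"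
    using that by (auto simp: ball_traces_def)
  have B: "B = (\<Union>I\<in>W. ?E I)"
    unfolding B_def A_def W_def using tr by blast
  have E: "?E I \<in> sets (P {..<n})" if "I \<in> W" for I
  proof -
    have "(\<lambda>S. of_bool (snd (S i)) - eta0 (fst (S i)) :: real) \<in> borel_measurable (P {..<n})" if "i \<in> I" for i
    proof -
      have "i \<in> {..<n}" using that \<open>I \<in> W\<close> by (auto simp: W_def)
      note [measurable] = component_measurable[OF this]
      show ?thesis by measurable
    qed
    then have [measurable]: "(\<lambda>S. dev S I) \<in> borel_measurable (P {..<n})"
      unfolding dev_def by (intro borel_measurable_abs borel_measurable_sum)
    show ?thesis by measurable
  qed
  show "B \<in> sets (P {..<n})" unfolding B using finW E by (intro sets.finite_UN) auto
  define c where "c = ennreal (2 * exp (- 2 * t\<^sup>2 * k))"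
  have Ele: "emeasure (P {..<n}) (?E I) \<le> c * emeasure (P {..<n}) (A I)" if "I \<in> W" for I
  proof -
    have "emeasure (P {..<n}) (?E I) \<le> ennreal (2 * exp (- 2 * t\<^sup>2 * card I)) * emeasure (P {..<n}) (A I)"
      unfolding dev_def
    proof (rule emeasure_deviation_le)
      show "S(i := (x, True)) \<in> A I \<longleftrightarrow> S(i := (x, False)) \<in> A I" if "i \<in> {..<n}" for S i x
      proof -
        have "(\<lambda>j. fst ((S(i := (x, True))) j)) = (\<lambda>j. fst ((S(i := (x, False))) j))"
          by auto
        then show ?thesis
          using that unfolding A_def
          by (auto simp: space_PiM PiE_iff extensional_def)
      qed
    qed (use t that in \<open>auto simp: W_def\<close>)
    also have "ennreal (2 * exp (- 2 * t\<^sup>2 * card I)) \<le> c"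
      unfolding c_def using that t by (intro ennreal_leI) (auto simp: W_def intro!: mult_left_mono)
    finally show ?thesis by (simp add: mult_right_mono)
  qed
  have sumA: "(\<Sum>I\<in>W. emeasure (P {..<n}) (A I)) \<le> ennreal ((real n + 1) ^ (DIM('a) + 1))"
  proof -
    have "(\<Sum>I\<in>W. emeasure (P {..<n}) (A I)) = (\<integral>\<^sup>+ S. (\<Sum>I\<in>W. indicator (A I) S) \<partial>P {..<n})"
      by (subst nn_integral_sum) auto
    also have "\<dots> \<le> (\<integral>\<^sup>+ S. ennreal ((real n + 1) ^ (DIM('a) + 1)) \<partial>P {..<n})"
    proof (rule nn_integral_mono)
      fix S :: "nat \<Rightarrow> 'a \<times> bool"
      let ?T = "ball_traces (\<lambda>i. fst (S i)) {..<n}"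
      have "(\<Sum>I\<in>W. indicator (A I) S :: ennreal) = of_nat (card {I\<in>W. S \<in> A I})"
        using finW by (simp add: indicator_def sum.If_cases Collect_conj_eq)
      also have "card {I\<in>W. S \<in> A I} \<le> card ?T"
        by (rule card_mono, rule finite_subset[of _ "Pow {..<n}"]) (use tr in \<open>auto simp: A_def\<close>)
      also have "card ?T \<le> (n + 1) ^ (DIM('a) + 1)"
        using card_ball_traces_le[of "{..<n}" "\<lambda>i. fst (S i)"] by simp
      also have "(of_nat ((n + 1) ^ (DIM('a) + 1)) :: ennreal) = ennreal ((real n + 1) ^ (DIM('a) + 1))"
        unfolding ennreal_of_nat_eq_real_of_nat by (simp add: add.commute del: power_Suc)
      finally show "(\<Sum>I\<in>W. indicator (A I) S) \<le> ennreal ((real n + 1) ^ (DIM('a) + 1))"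
        by (simp add: order_trans)
    qed
    also have "\<dots> = ennreal ((real n + 1) ^ (DIM('a) + 1))"
      using prob_space.emeasure_space_1[OF prob_space_P] by simp
    finally show ?thesis .
  qed
  have "emeasure (P {..<n}) B \<le> (\<Sum>I\<in>W. emeasure (P {..<n}) (?E I))"
    unfolding B using finW E by (intro emeasure_subadditive_finite) auto
  also have "\<dots> \<le> (\<Sum>I\<in>W. c * emeasure (P {..<n}) (A I))"
    by (rule sum_mono[OF Ele])
  also have "\<dots> \<le> c * ennreal ((real n + 1) ^ (DIM('a) + 1))"
    unfolding sum_distrib_left[symmetric] by (rule mult_left_mono[OF sumA]) simp
  finally show "emeasure (P {..<n}) B \<le> ennreal (2 * exp (- 2 * t\<^sup>2 * k) * (real n + 1) ^ (DIM('a) + 1))"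
    unfolding c_def by (simp add: ennreal_mult)
qed

section \<open>Lower tail for the number of sample points in a Borel set\<close>

text \<open>Chernoff's method with base 1/2: the expectation of 1/2 raised to the number of hits is
  at most \<open>exp (- q / 2) ^ n\<close>, while fewer than \<open>k\<close> hits make this
  variable at least \<open>(1 / 2) ^ k\<close>.\<close>

lemma emeasure_few_points_le:
  fixes n k :: nat
  assumes [measurable]: "B \<in> sets borel" and "0 \<le> q"
    and q: "ennreal q \<le> (\<integral>\<^sup>+ x. ennreal (p x) * indicator B x \<partial>lborel)"
  defines "F \<equiv> {S \<in> space (P {..<n}). card {i \<in> {..<n}. fst (S i) \<in> B} < k}"
  shows "F \<in> sets (P {..<n})" and "emeasure (P {..<n}) F \<le> ennreal (2 ^ k * exp (- q * n / 2))"
proof -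
  let ?c = "\<lambda>S. card {i \<in> {..<n}. fst (S i) \<in> B}"
  define g where "g = (\<lambda>x. ennreal (if x \<in> B then 1 / 2 else 1))"
  have g [measurable]: "g \<in> borel_measurable borel" unfolding g_def by measurable
  have prodg: "(\<Prod>i<n. g (fst (S i))) = ennreal ((1 / 2) ^ ?c S)" for S
  proof -
    have "(\<Prod>i<n. g (fst (S i))) = ennreal (\<Prod>i<n. if fst (S i) \<in> B then 1 / 2 else 1)"
      unfolding g_def by (rule prod_ennreal) auto
    also have "(\<Prod>i<n. if fst (S i) \<in> B then 1 / 2 else 1) = ((1 / 2) ^ ?c S :: real)"
      by (simp add: prod.If_cases Int_def)
    finally show ?thesis .
  qed
  have cm: "(\<lambda>S. real (?c S)) \<in> borel_measurable (P {..<n})"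
  proof -
    have "(\<lambda>S. indicator B (fst (S i)) :: real) \<in> borel_measurable (P {..<n})" if "i \<in> {..<n}" for i
      using fst_component_measurable[OF that] by measurable
    then have "(\<lambda>S. \<Sum>i<n. indicator B (fst (S i)) :: real) \<in> borel_measurable (P {..<n})"
      by (intro borel_measurable_sum)
    moreover have "(\<Sum>i<n. indicator B (fst (S i)) :: real) = real (?c S)" for S :: "nat \<Rightarrow> 'a \<times> bool"
      by (simp add: indicator_def sum.If_cases Int_def)
    ultimately show ?thesis by simp
  qed
  have "F = {S \<in> space (P {..<n}). real (?c S) < real k}" by (simp add: F_def)
  then show F [measurable]: "F \<in> sets (P {..<n})" using cm by simp
  have Eg: "(\<integral>\<^sup>+ z. g (fst z) \<partial>M) \<le> ennreal (exp (- q / 2))"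
  proof -
    \<comment> \<open>The relation between the mean of \<open>g\<close> and the mass of
      \<open>B\<close> is kept in additive form, because subtraction of extended nonnegative reals
      is truncated.\<close>
    have split: "ennreal (p x) * g x + ennreal (1 / 2) * (ennreal (p x) * indicator B x) = ennreal (p x)" for x
    proof -
      have "ennreal (p x) * ennreal (1 / 2) + ennreal (1 / 2) * ennreal (p x) = ennreal (p x * (1 / 2) + 1 / 2 * p x)"
        by (simp only: ennreal_plus ennreal_mult p_nonneg mult_nonneg_nonneg zero_le_divide_1_iff zero_le_numeral)
      then show ?thesis by (simp add: g_def indicator_def)
    qed
    have "(\<integral>\<^sup>+ z. g (fst z) \<partial>M) + ennreal (q / 2) \<le>
       (\<integral>\<^sup>+ x. ennreal (p x) * g x \<partial>lborel) + ennreal (1 / 2) * (\<integral>\<^sup>+ x. ennreal (p x) * indicator B x \<partial>lborel)"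
    proof (rule add_mono)
      have "ennreal (q / 2) = ennreal (1 / 2) * ennreal q"
        using \<open>0 \<le> q\<close> ennreal_mult[of "1 / 2" q] by simp
      then show "ennreal (q / 2) \<le> ennreal (1 / 2) * (\<integral>\<^sup>+ x. ennreal (p x) * indicator B x \<partial>lborel)"
        using q by (simp add: mult_left_mono)
    qed (simp add: nn_integral_M_fst)
    also have "\<dots> = (\<integral>\<^sup>+ x. ennreal (p x) * g x + ennreal (1 / 2) * (ennreal (p x) * indicator B x) \<partial>lborel)"
      by (subst nn_integral_cmult[symmetric], measurable, subst nn_integral_add[symmetric], measurable)
    also have "\<dots> = 1" unfolding split by (rule p_integral)
    finally have le1: "(\<integral>\<^sup>+ z. g (fst z) \<partial>M) + ennreal (q / 2) \<le> 1" .
    then obtain y where y: "0 \<le> y" "(\<integral>\<^sup>+ z. g (fst z) \<partial>M) = ennreal y"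
      by (cases "\<integral>\<^sup>+ z. g (fst z) \<partial>M") (auto simp: top_unique)
    have "ennreal (y + q / 2) \<le> ennreal 1"
      using le1 y \<open>0 \<le> q\<close> by simp
    then have "y + q / 2 \<le> 1" using ennreal_le_iff[of 1] by simp
    then have "y \<le> exp (- q / 2)" using exp_ge_add_one_self[of "- q / 2"] by simp
    then show ?thesis using y by (simp add: ennreal_leI)
  qed
  have "emeasure (P {..<n}) F = (\<integral>\<^sup>+ S. indicator F S \<partial>P {..<n})" by simp
  also have "\<dots> \<le> (\<integral>\<^sup>+ S. ennreal (2 ^ k) * (\<Prod>i<n. g (fst (S i))) \<partial>P {..<n})"
  proof (rule nn_integral_mono)
    fix S
    show "indicator F S \<le> ennreal (2 ^ k) * (\<Prod>i<n. g (fst (S i)))"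
    proof (cases "S \<in> F")
      case True
      then have "?c S \<le> k" by (simp add: F_def)
      then have "(1 / 2 :: real) ^ k \<le> (1 / 2) ^ ?c S" by (intro power_decreasing) auto
      then have "1 \<le> (2 :: real) ^ k * (1 / 2) ^ ?c S" by (simp add: field_simps)
      then have "1 \<le> ennreal (2 ^ k * (1 / 2) ^ ?c S)" by simp
      also have "\<dots> = ennreal (2 ^ k) * (\<Prod>i<n. g (fst (S i)))"
        unfolding prodg by (rule ennreal_mult) auto
      finally show ?thesis using True by simp
    qed simp
  qed
  also have "\<dots> = ennreal (2 ^ k) * (\<integral>\<^sup>+ S. (\<Prod>i<n. g (fst (S i))) \<partial>P {..<n})"
  proof (rule nn_integral_cmult)
    show "(\<lambda>S. \<Prod>i<n. g (fst (S i))) \<in> borel_measurable (P {..<n})"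
      by (intro borel_measurable_prod_ennreal measurable_compose[OF fst_component_measurable g]) auto
  qed
  also have "(\<integral>\<^sup>+ S. (\<Prod>i<n. g (fst (S i))) \<partial>P {..<n}) = (\<Prod>i<n. \<integral>\<^sup>+ z. g (fst z) \<partial>M)"
    by (rule PM.product_nn_integral_prod) auto
  also have "\<dots> = (\<integral>\<^sup>+ z. g (fst z) \<partial>M) ^ n" by simp
  also have "\<dots> \<le> ennreal (exp (- q / 2)) ^ n"
    by (rule power_mono[OF Eg]) simp
  also have "\<dots> = ennreal (exp (- q * n / 2))"
    by (simp add: ennreal_power exp_of_nat_mult[symmetric] mult.commute)
  also have "ennreal (2 ^ k) * \<dots> = ennreal (2 ^ k * exp (- q * n / 2))"
    by (simp add: ennreal_mult)
  finally show "emeasure (P {..<n}) F \<le> ennreal (2 ^ k * exp (- q * n / 2))"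
    by (simp add: mult_left_mono)
qed

section \<open>Mass of balls, finite nets and the support of the sample\<close>

lemma mass_ge_volume:
  assumes "0 \<le> p0" "\<And>x. x \<in> X \<Longrightarrow> p0 \<le> p x"
  shows "ennreal (p0 * measure lborel (X \<inter> cball c r)) \<le> (\<integral>\<^sup>+ x. ennreal (p x) * indicator (cball c r) x \<partial>lborel)"
proof -
  have "emeasure lborel (X \<inter> cball c r) \<le> emeasure lborel (cball c r)"
    by (rule emeasure_mono) auto
  also have "\<dots> < \<infinity>" using emeasure_bounded_finite[OF bounded_cball] by auto
  finally have "emeasure lborel (X \<inter> cball c r) = ennreal (measure lborel (X \<inter> cball c r))"
    by (intro emeasure_eq_ennreal_measure) auto
  then have "ennreal (p0 * measure lborel (X \<inter> cball c r)) = ennreal p0 * emeasure lborel (X \<inter> cball c r)"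
    using assms by (simp add: ennreal_mult)
  also have "\<dots> = (\<integral>\<^sup>+ x. ennreal p0 * indicator (X \<inter> cball c r) x \<partial>lborel)"
    by (rule nn_integral_cmult_indicator[symmetric]) simp
  also have "\<dots> \<le> (\<integral>\<^sup>+ x. ennreal (p x) * indicator (cball c r) x \<partial>lborel)"
    using assms by (intro nn_integral_mono) (auto simp: indicator_def intro!: ennreal_leI)
  finally show ?thesis .
qed

text \<open>The balls of half radius around a separated set are disjoint, so each of them having mass
  at least \<open>m\<close> bounds the size of the set.\<close>

lemma ex_finite_net:
  fixes m :: real
  assumes "0 < m" and m: "\<And>x. x \<in> X \<Longrightarrow>
      ennreal m \<le> (\<integral>\<^sup>+ y. ennreal (p y) * indicator (cball x (\<rho> / 2)) y \<partial>lborel)"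
  shows "\<exists>T\<subseteq>X. finite T \<and> card T * m \<le> 1 \<and> (\<forall>x\<in>X. \<exists>c\<in>T. dist x c \<le> \<rho>)"
proof -
  define sep where "sep = (\<lambda>T. T \<subseteq> X \<and> finite T \<and> (\<forall>a\<in>T. \<forall>b\<in>T. a \<noteq> b \<longrightarrow> \<rho> < dist a b))"
  have mass: "card T * m \<le> 1" if T: "sep T" for T
  proof -
    have [measurable]: "cball c s \<in> sets borel" for c :: 'a and s by simp
    have "ennreal (card T * m) = (\<Sum>c\<in>T. ennreal m)"
      using \<open>0 < m\<close> by (simp add: ennreal_mult ennreal_of_nat_eq_real_of_nat)
    also have "\<dots> \<le> (\<Sum>c\<in>T. \<integral>\<^sup>+ y. ennreal (p y) * indicator (cball c (\<rho> / 2)) y \<partial>lborel)"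
      using T m by (intro sum_mono) (auto simp: sep_def)
    also have "\<dots> = (\<integral>\<^sup>+ y. (\<Sum>c\<in>T. ennreal (p y) * indicator (cball c (\<rho> / 2)) y) \<partial>lborel)"
      by (rule nn_integral_sum[symmetric]) measurable
    also have "\<dots> \<le> (\<integral>\<^sup>+ y. ennreal (p y) \<partial>lborel)"
    proof (rule nn_integral_mono)
      fix y
      have eq: "a = b" if "a \<in> T" "b \<in> T" "y \<in> cball a (\<rho> / 2)" "y \<in> cball b (\<rho> / 2)" for a b
      proof (rule ccontr)
        assume "a \<noteq> b"
        then have "\<rho> < dist a b" using T that by (auto simp: sep_def)
        then show False using that dist_triangle2[of a b y] by (simp add: dist_commute)
      qed
      show "(\<Sum>c\<in>T. ennreal (p y) * indicator (cball c (\<rho> / 2)) y) \<le> ennreal (p y)"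
      proof (cases "\<exists>c\<in>T. y \<in> cball c (\<rho> / 2)")
        case True
        then obtain c where c: "c \<in> T" "y \<in> cball c (\<rho> / 2)" by auto
        have "(\<Sum>c\<in>T. ennreal (p y) * indicator (cball c (\<rho> / 2)) y) =
              (\<Sum>c\<in>{c}. ennreal (p y) * indicator (cball c (\<rho> / 2)) y)"
          using T c eq by (intro sum.mono_neutral_right) (auto simp: sep_def indicator_def)
        also have "\<dots> = ennreal (p y) * indicator (cball c (\<rho> / 2)) y"
          by (rule trans[OF sum.insert]) simp_all
        finally show ?thesis using c by simp
      next
        case False
        then have "(\<Sum>c\<in>T. ennreal (p y) * indicator (cball c (\<rho> / 2)) y) = 0"
          by (intro sum.neutral) (auto simp: indicator_def)
        then show ?thesis by simp
      qed
    qed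
    also have "\<dots> = ennreal 1" by (simp add: p_integral)
    finally show ?thesis using ennreal_le_iff[of 1] by simp
  qed
  have "sep {}" by (simp add: sep_def)
  moreover have "card T < Suc (nat \<lfloor>1 / m\<rfloor>)" if "sep T" for T
  proof -
    have "real (card T) \<le> 1 / m" using mass[OF that] \<open>0 < m\<close> by (simp add: field_simps)
    then show ?thesis by linarith
  qed
  \<comment> \<open>\<open>mass\<close> bounds the size of separated sets, so one of greatest
    cardinality exists; by maximality no point of \<open>X\<close> can be farther than
    \<open>\<rho>\<close> from all of it.\<close>
  ultimately obtain T where T: "sep T" "\<And>T'. sep T' \<Longrightarrow> card T' \<le> card T"
    using ex_has_greatest_nat[of sep "{}" card] by blast
  have "\<exists>c\<in>T. dist x c \<le> \<rho>" if "x \<in> X" for x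
  proof (rule ccontr)
    assume *: "\<not> (\<exists>c\<in>T. dist x c \<le> \<rho>)"
    then have "sep (insert x T)" using T(1) that by (auto simp: sep_def dist_commute not_le)
    then have "card (insert x T) \<le> card T" by (rule T(2))
    then have "x \<in> T" using T(1) by (auto simp: sep_def card_insert_if split: if_splits)
    \<comment> \<open>Being a member at distance 0 from itself, \<open>x\<close> forces a negative
      \<open>\<rho>\<close>. Its ball is then empty, against the positive mass
      \<open>m\<close>.\<close>
    then have "\<rho> < 0" using * by force
    have "ennreal m \<le> 0" using m[OF \<open>x \<in> X\<close>] \<open>\<rho> < 0\<close> by simp
    then show False using \<open>0 < m\<close> by simp
  qed
  then show ?thesis using T(1) mass by (auto simp: sep_def)
qed

text \<open>The density vanishes off \<open>X\<close>. On \<open>X\<close> the functions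
  \<open>eta0\<close> and \<open>eta\<close> agree, which ties the concentration bound to the given
  label function.\<close>

lemma AE_sample_in_X: "AE S in P {..<n}. \<forall>i\<in>{..<n}. fst (S i) \<in> X"
proof -
  have "{z \<in> space M. fst z \<in> - X} \<in> sets M" by measurable
  then have sets: "{z. fst z \<notin> X} \<in> sets M" by simp
  have "AE z in M. fst z \<in> X"
  proof (rule AE_I[where N = "{z. fst z \<notin> X}"])
    have "emeasure M {z. fst z \<notin> X} = (\<integral>\<^sup>+ z. indicator (- X) (fst z) \<partial>M)"
      unfolding nn_integral_indicator[OF sets, symmetric]
      by (intro nn_integral_cong) (simp split: split_indicator)
    also have "\<dots> = (\<integral>\<^sup>+ x. ennreal (p x) * indicator (- X) x \<partial>lborel)"
      by (rule nn_integral_M_fst) measurable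
    also have "\<dots> = (\<integral>\<^sup>+ (x::'a). 0 \<partial>lborel)"
      by (intro nn_integral_cong) (auto simp: indicator_def p_support)
    finally show "emeasure M {z. fst z \<notin> X} = 0" by simp
  qed (use sets in auto)
  then show ?thesis
    by (intro AE_finite_allI AE_PiM_component) (auto intro: prob_space_M)
qed

end

section \<open>The uniform error bound\<close>

text \<open>Supplies the measurability of \<open>eta\<close> on \<open>X\<close> that the model
  requires.\<close>

lemma Hoelder_imp_continuous_on:
  fixes f :: "'a::metric_space \<Rightarrow> real"
  assumes "0 < \<alpha>" "0 < C" and H: "\<And>x y. x \<in> X \<Longrightarrow> y \<in> X \<Longrightarrow> \<bar>f x - f y\<bar> \<le> C * dist x y powr \<alpha>"
  shows "continuous_on X f"
  unfolding continuous_on_iff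
proof (intro ballI allI impI)
  fix x and e :: real assume "x \<in> X" "0 < e"
  define d where "d = (e / C) powr (1 / \<alpha>)"
  have "0 < d" using \<open>0 < e\<close> assms by (simp add: d_def)
  moreover have "dist (f y) (f x) < e" if "y \<in> X" "dist y x < d" for y
  proof -
    have "dist y x powr \<alpha> < d powr \<alpha>" using that assms by (intro powr_less_mono2) auto
    also have "d powr \<alpha> = e / C" using assms \<open>0 < e\<close> by (simp add: d_def powr_powr)
    finally have "C * dist y x powr \<alpha> < e" using assms by (simp add: field_simps)
    then show ?thesis using H[OF \<open>y \<in> X\<close> \<open>x \<in> X\<close>] by (simp add: dist_real_def)
  qed
  ultimately show "\<exists>d>0. \<forall>y\<in>X. dist y x < d \<longrightarrow> dist (f y) (f x) < e" by blast
qed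

text \<open>The numerical side of the argument. With
  \<open>L = ln (4 / \<delta>) \<ge> 4 / 3\<close> and \<open>u = D * ln n \<ge> 2 / 3\<close>, the
  bound \<open>k \<ge> 256 * L\<^sup>2 * u\<close> dominates \<open>u\<close>, \<open>ln n\<close>
  and \<open>L\<close> simultaneously. The three conclusions serve the size of the net, the union
  over the net and the union over the traces.\<close>

lemma sample_size_bounds:
  fixes n k D :: nat and \<delta> :: real
  assumes \<delta>: "0 < \<delta>" "\<delta> < 1" and "1 \<le> D" "1 \<le> k"
    and k: "2 ^ 8 * real D * (ln (4 / \<delta>))\<^sup>2 * ln (real n) \<le> real k"
    and n: "9 / 5 * real k \<le> real n"
  shows "20 * D \<le> n"
    and "real n ^ (D + 1) * (2 ^ k * exp (- 9 / 10 * real k)) \<le> \<delta> / 4"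
    and "2 * exp (- 2 * (2 * ln (4 * real D / \<delta>) + 2 * real D * ln (real n))) * (real n + 1) ^ (D + 1) \<le> \<delta> / 4"
proof -
  define L where "L = ln (4 / \<delta>)"
  define l where "l = ln (real n)"
  define u where "u = real D * l"
  have n2: "2 \<le> n" using n \<open>1 \<le> k\<close> by linarith
  have "ln 4 = 2 * ln (2::real)" using ln_realpow[of 2 2] by simp
  moreover have "ln 4 \<le> L" using \<delta> by (simp add: L_def field_simps)
  ultimately have L: "4 / 3 \<le> L" using ln2_ge_two_thirds by simp
  have "ln 2 \<le> l" using n2 by (simp add: l_def)
  then have l: "2 / 3 \<le> l" using ln2_ge_two_thirds by simp
  have u: "2 / 3 * real D \<le> u"
    unfolding u_def using l mult_left_mono[OF l, of "real D"] by (simp add: mult.commute)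
  then have u': "2 / 3 \<le> u" using \<open>1 \<le> D\<close> by linarith
  have k': "256 * (L\<^sup>2 * u) \<le> real k" using k by (simp add: L_def l_def u_def mult_ac)
  have L2: "L \<le> L\<^sup>2" "1 \<le> L\<^sup>2" using L self_le_power[of L 2] one_le_power[of L 2] by simp_all
  have "u \<le> L\<^sup>2 * u" using L2 u' mult_right_mono[of 1 "L\<^sup>2" u] by simp
  then have "256 * (2 / 3 * real D) \<le> real k" using k' u by linarith
  then show "20 * D \<le> n" using n by linarith
  have expL: "exp (- L) = \<delta> / 4" using \<delta> by (simp add: L_def exp_minus)
  have npow: "real n ^ j = exp (real j * l)" for j
    using n2 by (simp add: l_def exp_of_nat_mult)
  have Dl: "l \<le> u" unfolding u_def using \<open>1 \<le> D\<close> l mult_right_mono[of 1 "real D" l] by simp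
  have L2u: "L * (2 / 3) \<le> L\<^sup>2 * u" using L2 L u' by (intro mult_mono) auto
  have two: "2 ^ k = exp (real k * ln 2)" by (simp add: exp_of_nat_mult)
  have "real n ^ (D + 1) * (2 ^ k * exp (- 9 / 10 * real k)) =
        exp (real (D + 1) * l + (real k * ln 2 + - 9 / 10 * real k))"
    unfolding npow two exp_add by (rule refl)
  also have "\<dots> \<le> exp (- L)"
  proof -
    \<comment> \<open>\<open>9 / 10\<close> exceeds the bound \<open>25 / 36\<close> for
      \<open>ln 2\<close> by \<open>37 / 180\<close>, so the exponent keeps a negative multiple of
      \<open>k\<close> that outweighs \<open>u + l + L\<close>.\<close>
    have "real k * ln 2 \<le> real k * (25 / 36)" using ln2_le_25_over_36 by (intro mult_left_mono) auto
    moreover have "real (D + 1) * l = u + l" by (simp add: u_def algebra_simps)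
    ultimately have "real (D + 1) * l + (real k * ln 2 + - 9 / 10 * real k) \<le> - L"
      using k' Dl \<open>u \<le> L\<^sup>2 * u\<close> L2u L by linarith
    then show ?thesis by simp
  qed
  finally show "real n ^ (D + 1) * (2 ^ k * exp (- 9 / 10 * real k)) \<le> \<delta> / 4"
    by (simp only: expL)
  \<comment> \<open>Valid as \<open>n \<ge> 2\<close>; it doubles the exponent but leaves pure
    powers of \<open>n\<close>.\<close>
  have "real n + 1 \<le> real n ^ 2"
  proof -
    have "2 * real n \<le> real n * real n" using n2 by (intro mult_right_mono) auto
    then show ?thesis using n2 unfolding power2_eq_square by linarith
  qed
  then have "(real n + 1) ^ (D + 1) \<le> (real n ^ 2) ^ (D + 1)"
    by (intro power_mono) auto
  also have "\<dots> = real n ^ (2 * (D + 1))" by (rule power_mult[symmetric])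
  also have "\<dots> = exp (2 * u + 2 * l)"
    unfolding npow by (simp add: u_def algebra_simps)
  finally have npl: "(real n + 1) ^ (D + 1) \<le> exp (2 * u + 2 * l)" .
  have L4: "L \<le> ln (4 * real D / \<delta>)"
    unfolding L_def using \<delta> \<open>1 \<le> D\<close> by (intro ln_mono) (auto simp: field_simps)
  have "2 * exp (- 2 * (2 * ln (4 * real D / \<delta>) + 2 * real D * l)) * (real n + 1) ^ (D + 1)
      \<le> exp (ln 2) * exp (- 2 * (2 * ln (4 * real D / \<delta>) + 2 * real D * l)) * exp (2 * u + 2 * l)"
    using npl by (intro mult_mono) auto
  also have "\<dots> = exp (ln 2 + - 2 * (2 * ln (4 * real D / \<delta>) + 2 * real D * l) + (2 * u + 2 * l))"
    by (simp only: exp_add)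
  also have "\<dots> \<le> exp (- L)"
  proof -
    \<comment> \<open>The exponent is \<open>ln 2 - 4 * w - 2 * u + 2 * l\<close>; since
      \<open>l \<le> u\<close> and \<open>L \<le> w\<close>, it is at most
      \<open>ln 2 - 4 * L\<close>, and \<open>L\<close> exceeds \<open>ln 2\<close>.\<close>
    define w where "w = ln (4 * real D / \<delta>)"
    have "2 * real D * l = 2 * u" by (simp add: u_def)
    then show ?thesis
      using L4 L Dl ln2_le_25_over_36 unfolding exp_le_cancel_iff w_def[symmetric] by simp
  qed
  finally show "2 * exp (- 2 * (2 * ln (4 * real D / \<delta>) + 2 * real D * ln (real n))) * (real n + 1) ^ (D + 1) \<le> \<delta> / 4"
    unfolding l_def expL .
qed

theorem theorem1:
  fixes X :: "'a::euclidean_space set"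
    and p eta :: "'a \<Rightarrow> real"
    and \<omega> r\<^sub>0 C\<^sub>\<alpha> \<alpha> \<delta> :: real
    and n k :: nat
  assumes delta: "0 < \<delta>" "\<delta> < 1"
    and compact: "compact X"
    and dens_meas: "p \<in> borel_measurable lborel"
    and dens_nonneg: "\<And>x. 0 \<le> p x"
    and dens_supp: "\<And>x. x \<notin> X \<Longrightarrow> p x = 0"
    and dens_int: "(\<integral>\<^sup>+ x. ennreal (p x) \<partial>lborel) = 1"
    and eta_range: "\<And>x. x \<in> X \<Longrightarrow> 0 \<le> eta x \<and> eta x \<le> 1"
    and A1: "0 < \<omega>" "0 < r\<^sub>0"
       "\<And>x r. x \<in> X \<Longrightarrow> 0 < r \<Longrightarrow> r < r\<^sub>0 \<Longrightarrow>
          measure lborel (X \<inter> cball x r) \<ge> \<omega> * measure lborel (cball x r)"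
    and A2: "(INF x\<in>X. p x) > 0"
    and A3: "0 < \<alpha>" "\<alpha> \<le> 1" "0 < C\<^sub>\<alpha>"
       "\<And>x x'. x \<in> X \<Longrightarrow> x' \<in> X \<Longrightarrow> \<bar>eta x - eta x'\<bar> \<le> C\<^sub>\<alpha> * dist x x' powr \<alpha>"
    and k_pos: "1 \<le> k"
    and k_lower: "2 ^ 8 * real DIM('a) * (ln (4 / \<delta>))\<^sup>2 * ln (real n) \<le> real k"
    and k_upper: "real k \<le> 1 / 2 * \<omega> * (INF x\<in>X. p x) * unit_ball_vol (real DIM('a))
                                * r\<^sub>0 ^ DIM('a) * real n"
  shows "\<exists>E \<in> sets (sample_dist n X p eta).
           measure (sample_dist n X p eta) E \<ge> 1 - \<delta> \<and>
           (\<forall>S \<in> E. \<forall>x \<in> X.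
              \<bar>knn_label S n k x - eta x\<bar>
                \<le> C\<^sub>\<alpha> * (2 * real k / (\<omega> * unit_ball_vol (real DIM('a)) * real n * (INF x\<in>X. p x)))
                      powr (\<alpha> / real DIM('a))
                  + sqrt ((2 * ln (4 * real DIM('a) / \<delta>) + 2 * real DIM('a) * ln (real n)) / real k))"
proof -
  have X [measurable]: "X \<in> sets borel" using compact by (simp add: compact_imp_closed)
  have "continuous_on X eta" using Hoelder_imp_continuous_on[OF A3(1,3,4)] .
  then have eta_m: "(\<lambda>x. indicator X x * eta x) \<in> borel_measurable borel"
    using borel_measurable_continuous_on_indicator[of X eta] X by simp
  interpret classification_model X p eta
    by standard (use dens_meas dens_nonneg dens_supp dens_int eta_range eta_m in auto)
  let ?D = "DIM('a)"
  define v where "v = unit_ball_vol (real ?D)"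
  define p0 where "p0 = (INF x\<in>X. p x)"
  have v: "0 < v" by (simp add: v_def)
  have p0: "0 < p0" using A2 by (simp add: p0_def)
  have D: "1 \<le> ?D" using DIM_positive[where 'a = 'a] by linarith
  have p0_le: "p0 \<le> p x" if "x \<in> X" for x
    unfolding p0_def using that dens_nonneg by (intro cINF_lower bdd_belowI2[of _ 0]) auto
  have n: "0 < n" using k_upper k_pos by (cases n) auto
  define Q where "Q = 2 * real k / (\<omega> * v * real n * p0)"
  have Q: "0 < Q" using A1 v n p0 k_pos by (simp add: Q_def)
  define r where "r = Q powr (1 / real ?D)"
  have r: "0 < r" using Q by (simp add: r_def)
  have rD: "r ^ ?D = Q" using Q D by (simp add: r_def powr_realpow[symmetric] powr_powr)
  have r_r0: "r \<le> r\<^sub>0"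
  proof (rule power_le_imp_le_base)
    show "r ^ Suc (?D - 1) \<le> r\<^sub>0 ^ Suc (?D - 1)"
    proof -
      have "Q \<le> r\<^sub>0 ^ ?D"
        using k_upper A1 v n p0 unfolding Q_def v_def[symmetric] p0_def[symmetric]
        by (subst pos_divide_le_eq) (auto simp: mult_ac)
      then show ?thesis using rD by simp
    qed
  qed (use A1 in simp)
  \<comment> \<open>Support regularity is assumed for radii strictly below \<open>r\<^sub>0\<close>,
    while only \<open>r \<le> r\<^sub>0\<close> is known, hence the contraction
    \<open>s < 1\<close>. It is applied with \<open>1 - \<epsilon>\<close> for counting and
    \<open>\<epsilon> / 2\<close> for the net.\<close>
  have mass: "ennreal (2 * k / n * s ^ ?D) \<le> (\<integral>\<^sup>+ y. ennreal (p y) * indicator (cball x (s * r)) y \<partial>lborel)"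
    if "x \<in> X" "0 < s" "s < 1" for x s
  proof -
    have "s * r < r" using that r by simp
    then have "s * r < r\<^sub>0" using r_r0 by linarith
    then have "\<omega> * measure lborel (cball x (s * r)) \<le> measure lborel (X \<inter> cball x (s * r))"
      using that r by (intro A1(3)) auto
    moreover have "measure lborel (cball x (s * r)) = v * (s ^ ?D * Q)"
      using that r by (simp add: content_cball v_def power_mult_distrib rD)
    ultimately have "p0 * (\<omega> * (v * (s ^ ?D * Q))) \<le> p0 * measure lborel (X \<inter> cball x (s * r))"
      using p0 by (intro mult_left_mono) auto
    moreover have "p0 * (\<omega> * (v * (s ^ ?D * Q))) = 2 * k / n * s ^ ?D"
      using p0 A1 v n by (simp add: Q_def)
    ultimately have "ennreal (2 * k / n * s ^ ?D) \<le> ennreal (p0 * measure lborel (X \<inter> cball x (s * r)))"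
      by (intro ennreal_leI) simp
    also have "\<dots> \<le> (\<integral>\<^sup>+ y. ennreal (p y) * indicator (cball x (s * r)) y \<partial>lborel)"
      using p0 p0_le by (intro mass_ge_volume) auto
    finally show ?thesis .
  qed
  \<comment> \<open>By Bernoulli's inequality this choice gives
    \<open>(1 - \<epsilon>) ^ DIM('a) \<ge> 9 / 10\<close>: contracted balls keep at least nine
    tenths of the mass \<open>2 * k / n\<close>, and nine tenths of it is \<open>q\<close>.\<close>
  define \<epsilon> where "\<epsilon> = 1 / (10 * real ?D)"
  have "1 < 10 * real ?D" using D by linarith
  then have eps: "0 < \<epsilon>" "\<epsilon> < 1" "real ?D * \<epsilon> = 1 / 10" unfolding \<epsilon>_def by auto
  define q where "q = 9 / 5 * real k / real n"
  have "9 / 10 \<le> (1 - \<epsilon>) ^ ?D"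
    using Bernoulli_inequality[of "- \<epsilon>" ?D] eps by simp
  then have "q \<le> 2 * k / n * (1 - \<epsilon>) ^ ?D"
    using mult_left_mono[of "9 / 10" "(1 - \<epsilon>) ^ ?D" "2 * k / n"] by (simp add: q_def)
  then have mass_q: "ennreal q \<le> (\<integral>\<^sup>+ y. ennreal (p y) * indicator (cball x ((1 - \<epsilon>) * r)) y \<partial>lborel)"
    if "x \<in> X" for x
    using mass[OF that, of "1 - \<epsilon>"] eps by (meson ennreal_leI order_trans diff_gt_0_iff_gt diff_less_eq less_add_same_cancel1)
  have "X \<noteq> {}" using dens_int dens_supp by force
  then obtain x0 where "x0 \<in> X" by auto
  \<comment> \<open>A lower bound for a probability is at most 1; this is the source of
    \<open>9 / 5 * k \<le> n\<close>.\<close>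
  have "ennreal q \<le> (\<integral>\<^sup>+ y. ennreal (p y) \<partial>lborel)"
    by (rule order_trans[OF mass_q[OF \<open>x0 \<in> X\<close>]]) (auto intro!: nn_integral_mono split: split_indicator)
  then have "ennreal q \<le> ennreal 1" by (simp add: dens_int)
  then have "q \<le> 1" using ennreal_le_iff[of 1] by simp
  then have kn: "9 / 5 * real k \<le> real n" using n by (simp add: q_def field_simps)
  note arith = sample_size_bounds[OF delta D k_pos k_lower kn]
  \<comment> \<open>The mass bound for balls of radius \<open>\<epsilon> * r / 2\<close>, half the
    mesh, as the packing argument requires.\<close>
  define m where "m = 2 * k / n * (\<epsilon> / 2) ^ ?D"
  have m: "0 < m" using k_pos n eps by (simp add: m_def)
  have "\<exists>T\<subseteq>X. finite T \<and> card T * m \<le> 1 \<and> (\<forall>x\<in>X. \<exists>c\<in>T. dist x c \<le> \<epsilon> * r)"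
    using m mass[of _ "\<epsilon> / 2"] eps by (intro ex_finite_net) (auto simp: m_def)
  then obtain T where T: "T \<subseteq> X" "finite T" "card T * m \<le> 1" "\<And>x. x \<in> X \<Longrightarrow> \<exists>c\<in>T. dist x c \<le> \<epsilon> * r"
    by blast
  \<comment> \<open>With \<open>D\<close> the dimension, \<open>\<epsilon> / 2\<close> is
    \<open>1 / (20 * D)\<close>, so \<open>1 / m\<close> equals
    \<open>n * (20 * D) ^ D / (2 * k)\<close>; now \<open>20 * D \<le> n\<close> and
    \<open>1 \<le> k\<close> apply.\<close>
  have cardT: "real (card T) \<le> real n ^ (?D + 1)"
  proof -
    have "(\<epsilon> / 2) ^ ?D * (20 * real ?D) ^ ?D = 1"
      unfolding power_mult_distrib[symmetric] using D by (simp add: \<epsilon>_def)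
    then have "m * (real n * (20 * real ?D) ^ ?D) = 2 * k"
      using n by (simp add: m_def)
    then have "1 * 1 \<le> m * (real n * (20 * real ?D) ^ ?D)" using k_pos by simp
    moreover have "(20 * real ?D) ^ ?D \<le> real n ^ ?D"
      using arith(1) by (intro power_mono) linarith+
    then have "m * (real n * (20 * real ?D) ^ ?D) \<le> m * (real n * real n ^ ?D)"
      using m by (intro mult_left_mono) auto
    ultimately have "real (card T) * m \<le> real n ^ (?D + 1) * m"
      using T(3) by (simp add: mult_ac)
    then show ?thesis using m by simp
  qed
  define t where "t = sqrt ((2 * ln (4 * real ?D / \<delta>) + 2 * real ?D * ln (real n)) / real k)"
  have "\<delta> < 4 * real ?D" using delta D by linarith
  then have "0 < ln (4 * real ?D / \<delta>)" using delta by simp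
  then have arg: "0 < 2 * ln (4 * real ?D / \<delta>) + 2 * real ?D * ln (real n)"
    using n by (intro add_pos_nonneg) auto
  then have t: "0 < t" using k_pos by (simp add: t_def)
  \<comment> \<open>The variance term is exactly the \<open>t\<close> for which Hoeffding's exponent
    \<open>2 * t\<^sup>2 * k\<close> becomes the one in the third arithmetic bound.\<close>
  have t2: "t\<^sup>2 * real k = 2 * ln (4 * real ?D / \<delta>) + 2 * real ?D * ln (real n)"
    using arg k_pos by (simp add: t_def)
  interpret P: prob_space "P {..<n}" by (rule prob_space_P)
  define F where "F = (\<lambda>c. {S \<in> space (P {..<n}). card {i \<in> {..<n}. fst (S i) \<in> cball c ((1 - \<epsilon>) * r)} < k})"
  define B where "B = {S \<in> space (P {..<n}). \<exists>I\<in>ball_traces (\<lambda>i. fst (S i)) {..<n}.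
      k \<le> card I \<and> t * card I < \<bar>\<Sum>i\<in>I. of_bool (snd (S i)) - eta0 (fst (S i))\<bar>}"
  have F: "F c \<in> sets (P {..<n})" "emeasure (P {..<n}) (F c) \<le> ennreal (2 ^ k * exp (- 9 / 10 * real k))"
    if "c \<in> T" for c
  proof -
    have "0 \<le> q" by (simp add: q_def)
    note * = emeasure_few_points_le[OF _ this mass_q, where n = n and k = k]
    show "F c \<in> sets (P {..<n})" using *(1)[of c] T(1) that by (auto simp: F_def)
    have eq: "- 9 / 10 * real k = - q * n / 2" using n by (simp add: q_def)
    show "emeasure (P {..<n}) (F c) \<le> ennreal (2 ^ k * exp (- 9 / 10 * real k))"
      unfolding F_def eq by (rule *(2)) (use T(1) that in auto)
  qed
  have B: "B \<in> sets (P {..<n})" "emeasure (P {..<n}) B \<le> ennreal (\<delta> / 4)"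
  proof -
    show "B \<in> sets (P {..<n})" unfolding B_def by (rule emeasure_trace_deviation_le(1)[OF t])
    have "emeasure (P {..<n}) B \<le> ennreal (2 * exp (- 2 * t\<^sup>2 * k) * (real n + 1) ^ (?D + 1))"
      unfolding B_def by (rule emeasure_trace_deviation_le(2)[OF t])
    also have "\<dots> \<le> ennreal (\<delta> / 4)"
      using arith(3) unfolding t2[symmetric] by (intro ennreal_leI) (simp only: mult.assoc)
    finally show "emeasure (P {..<n}) B \<le> ennreal (\<delta> / 4)" .
  qed
  \<comment> \<open>The bad event: a trace with large noise, or a net ball with fewer than
    \<open>k\<close> points. Each of the two parts costs at most
    \<open>\<delta> / 4\<close>.\<close>
  define G where "G = B \<union> (\<Union>c\<in>T. F c)"
  have G [measurable]: "G \<in> sets (P {..<n})"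
    unfolding G_def using B F T(2) by (intro sets.Un sets.finite_UN) auto
  have "emeasure (P {..<n}) (\<Union>c\<in>T. F c) \<le> (\<Sum>c\<in>T. emeasure (P {..<n}) (F c))"
    using F T(2) by (intro emeasure_subadditive_finite) auto
  also have "\<dots> \<le> (\<Sum>c\<in>T. ennreal (2 ^ k * exp (- 9 / 10 * real k)))"
    by (rule sum_mono[OF F(2)])
  also have "\<dots> = ennreal (card T * (2 ^ k * exp (- 9 / 10 * real k)))"
    by (simp add: ennreal_mult ennreal_of_nat_eq_real_of_nat)
  also have "\<dots> \<le> ennreal (\<delta> / 4)"
    by (intro ennreal_leI order_trans[OF mult_right_mono[OF cardT] arith(2)]) simp
  finally have F_le: "emeasure (P {..<n}) (\<Union>c\<in>T. F c) \<le> ennreal (\<delta> / 4)" .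
  have "emeasure (P {..<n}) G \<le> emeasure (P {..<n}) B + emeasure (P {..<n}) (\<Union>c\<in>T. F c)"
    unfolding G_def using B F T(2) by (intro emeasure_subadditive sets.finite_UN) auto
  also have "\<dots> \<le> ennreal (\<delta> / 4) + ennreal (\<delta> / 4)"
    by (rule add_mono[OF B(2) F_le])
  finally have "ennreal (P.prob G) \<le> ennreal (\<delta> / 2)"
    using delta by (simp add: P.emeasure_eq_measure ennreal_plus[symmetric] del: ennreal_plus)
  then have PG: "P.prob G \<le> \<delta> / 2" using delta by simp
  \<comment> \<open>Samples leaving \<open>X\<close> form a null set; removing them makes the error
    bound hold for every sample in \<open>E\<close> at no cost in probability.\<close>
  define E where "E = {S \<in> space (P {..<n}). \<forall>i\<in>{..<n}. fst (S i) \<in> X} - G"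
  have E1: "{S \<in> space (P {..<n}). \<forall>i\<in>{..<n}. fst (S i) \<in> X} \<in> sets (P {..<n})"
  proof (intro sets.sets_Collect_finite_All)
    fix i assume "i \<in> {..<n}"
    note [measurable] = fst_component_measurable[OF this]
    show "{S \<in> space (P {..<n}). fst (S i) \<in> X} \<in> sets (P {..<n})" by measurable
  qed simp
  have E: "E \<in> sets (P {..<n})" unfolding E_def using E1 by auto
  have "P.prob E = P.prob (space (P {..<n}) - G)"
  proof (rule measure_eq_AE)
    show "AE S in P {..<n}. S \<in> E \<longleftrightarrow> S \<in> space (P {..<n}) - G"
      using AE_sample_in_X[of n] by eventually_elim (auto simp: E_def)
  qed (use E in auto)
  also have "\<dots> = 1 - P.prob G" by (rule P.prob_compl[OF G])
  finally have PE: "1 - \<delta> \<le> P.prob E" using PG delta by simp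
  have main: "\<bar>knn_label S n k x - eta x\<bar> \<le> C\<^sub>\<alpha> * r powr \<alpha> + t" if S: "S \<in> E" and x: "x \<in> X" for S x
  proof (rule knn_label_error_le[where X = X])
    show SX: "fst (S i) \<in> X" if "i < n" for i using S that by (auto simp: E_def)
    obtain c where c: "c \<in> T" "dist x c \<le> \<epsilon> * r" using T(4)[OF x] by auto
    have "S \<notin> F c" using S c by (auto simp: E_def G_def)
    then have "k \<le> card {i \<in> {..<n}. fst (S i) \<in> cball c ((1 - \<epsilon>) * r)}"
      using S by (auto simp: F_def E_def)
    also have "\<dots> \<le> knn_count S n x r"
      unfolding knn_count_def
    proof (intro card_mono subsetI)
      fix i assume "i \<in> {i \<in> {..<n}. fst (S i) \<in> cball c ((1 - \<epsilon>) * r)}"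
      moreover have "dist x (fst (S i)) \<le> dist x c + dist c (fst (S i))" by (rule dist_triangle)
      ultimately show "i \<in> {i \<in> {..<n}. dist x (fst (S i)) \<le> r}"
        using c by (auto simp: algebra_simps)
    qed simp
    finally show count: "k \<le> knn_count S n x r" .
    let ?N = "knn_set S n k x"
    have "k \<le> card ?N" by (rule card_knn_set_ge[OF k_pos count])
    moreover have "S \<notin> B" "S \<in> space (P {..<n})" using S by (auto simp: E_def G_def)
    ultimately have "\<bar>\<Sum>i\<in>?N. of_bool (snd (S i)) - eta0 (fst (S i))\<bar> \<le> t * card ?N"
      using knn_set_in_ball_traces[of S n k x] by (force simp: B_def)
    moreover have "(\<Sum>i\<in>?N. of_bool (snd (S i)) - eta0 (fst (S i))) =
        (\<Sum>i\<in>?N. of_bool (snd (S i)) - eta (fst (S i)))"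
      using SX by (intro sum.cong) (auto simp: eta0_def knn_set_def)
    ultimately show "\<bar>\<Sum>i\<in>?N. of_bool (snd (S i)) - eta (fst (S i))\<bar> \<le> t * card ?N" by simp
  qed (use A3 k_pos x in auto)
  have "r powr \<alpha> = Q powr (\<alpha> / real ?D)" by (simp add: r_def powr_powr)
  then show ?thesis
    using E PE main unfolding sample_dist_def Q_def v_def p0_def t_def by (intro bexI[of _ E]) auto
qed

end
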